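(* Let $G$ and $H$ be compactly generated locally compact groups equipped with left Haar measures $\mu_G$ and $\mu_H$ and word metrics associated to compact generating subsets. Let $\phi:G\to H$ be a continuous proper cocompact morphism. Then $\phi$ is a measure-scaling quasi-isometry. In particular, whenever these scaling groups are defined (i.e. when $G$ and $H$ are amenable as metric measure spaces), $\mathrm{Sc}(H)=\mathrm{Sc}(G)$.
   Context: A continuous morphism $\phi:G\to H$ is proper if preimages of compact sets are compact, and cocompact if $H=\phi(G)K$ for some compact $K\subset H$. A metric measure space is a triple $(X,d,\mu)$ where $X$ is a locally compact topological space, $\mu$ is a non-trivial locally finite Borel measure, and $d$ is a measurable distance on $X$ (not required to be continuous) whose balls are relatively compact. It is standard if: (a) for all $r\geq 1$ there exist $V_r\geq v_r>0$ with $v_r\leq\mu(B(x,r))\leq V_r$ for all $x\in X$; and (b) for all $x,y\in X$ there is a sequence $x=x_0,\ldots,x_n=y$ with $d(x_{i-1},x_i)\leq 1$ for all $i$ and $d(x,y)=\sum_{i=1}^n d(x_{i-1},x_i)$. A compactly generated locally compact group, with a left Haar measure and the left-invariant word metric $d_S$ of a compact symmetric generating set $S$ with non-empty interior, is a standard metric measure space. For $A\subset X$ and $R>0$, $A^{+R}=\{x: d(x,A)\leq R\}$ and $\partial_R A=A^{+R}\cap (X\setminus A)^{+R}$. A subset is thick if it is a union of closed balls of radius $1$. $X$ is amenable if there are thick subsets $A_n$ of finite measure with $\mu(\partial_RA_n)/\mu(A_n)\to 0$ for all $R>0$ (for a compactly generated locally compact group equipped with a left Haar measure and the left-invariant word metric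 of a compact symmetric generating set with non-empty interior, this means that the group is amenable and unimodular). A map $f:X\to Y$ between metric spaces is a quasi-isometry if there are $C\geq 1$, $K\geq 0$ with $\frac1C d(x,y)-K\leq d(f(x),f(y))\leq C d(x,y)+K$ for all $x,y\in X$ and every point of $Y$ is within distance $K$ of $f(X)$. For $\kappa>0$, a measurable map $f:(X,\mu)\to(Y,\nu)$ between standard metric measure spaces is quasi-$\kappa$-to-one if there is a constant $C>0$ such that $|\kappa\,\nu(A)-\mu(f^{-1}(A))|\leq C\,\nu(\partial_2A)$ for every measurable thick subset $A\subset Y$ of finite measure (with $\nu(\partial_2 A)$ read as outer measure if necessary). A measure-scaling quasi-isometry is a measurable quasi-isometry that is quasi-$\kappa$-to-one for some $\kappa>0$, called a scaling factor; when the spaces are amenable, $\kappa$ is unique. For $X$ an amenable standard metric measure space, the scaling group $\mathrm{Sc}(X)\subset\mathbb{R}_{>0}$ is the set (in fact a multiplicative subgroup) of scaling factors of measure-scaling quasi-isometries $X\to X$. *)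

theory Defs
  imports "HOL-Analysis.Analysis"
begin

section \<open>Metric measure spaces\<close>

text \<open>
  The distance is an explicit argument: it is not assumed to be compatible with the topology of
  the underlying type. It is only required to be Borel measurable on the topological product
  \<open>X \<times> X\<close>. Balls are closed balls throughout (for an integer-valued distance, open balls of
  radius 1 are points).
\<close>

definition metric_measure_space ::
    "('a::topological_space \<Rightarrow> 'a \<Rightarrow> real) \<Rightarrow> 'a measure \<Rightarrow> bool" where
  "metric_measure_space d M \<longleftrightarrow>
     locally_compact_space (euclidean :: 'a topology) \<and>
     sets M = sets borel \<and>
     emeasure M UNIV \<noteq> 0 \<and>
     (\<forall>x. \<exists>U. open U \<and> x \<in> U \<and> emeasure M U < \<infinity>) \<and>
     Metric_space UNIV d \<and>
     (\<lambda>(x, y). d x y) \<in> borel_measurable (borel :: ('a \<times> 'a) measure) \<and>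
     (\<forall>x r. compact (closure (Metric_space.mcball UNIV d x r)))"

definition standard_mms ::
    "('a::topological_space \<Rightarrow> 'a \<Rightarrow> real) \<Rightarrow> 'a measure \<Rightarrow> bool" where
  "standard_mms d M \<longleftrightarrow>
     metric_measure_space d M \<and>
     (\<forall>r\<ge>1. \<exists>v V :: real. 0 < v \<and> v \<le> V \<and>
        (\<forall>x. ennreal v \<le> emeasure M (Metric_space.mcball UNIV d x r) \<and>
             emeasure M (Metric_space.mcball UNIV d x r) \<le> ennreal V)) \<and>
     (\<forall>x y. \<exists>(n::nat) z. z 0 = x \<and> z n = y \<and>
        (\<forall>i\<in>{1..n}. d (z (i - 1)) (z i) \<le> 1) \<and>
        d x y = (\<Sum>i=1..n. d (z (i - 1)) (z i)))"

text \<open>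
  The infimum is taken in the extended reals, so the distance to the empty set is \<open>\<infinity>\<close> and the
  neighbourhoods of the empty set are empty.
\<close>

definition nbhd :: "('a \<Rightarrow> 'a \<Rightarrow> real) \<Rightarrow> real \<Rightarrow> 'a set \<Rightarrow> 'a set" where
  "nbhd d R A = {x. (INF a\<in>A. ereal (d x a)) \<le> ereal R}"

definition boundary :: "('a \<Rightarrow> 'a \<Rightarrow> real) \<Rightarrow> real \<Rightarrow> 'a set \<Rightarrow> 'a set" where
  "boundary d R A = nbhd d R A \<inter> nbhd d R (- A)"

definition thick :: "('a \<Rightarrow> 'a \<Rightarrow> real) \<Rightarrow> 'a set \<Rightarrow> bool" where
  "thick d A \<longleftrightarrow> (\<exists>C. A = (\<Union>c\<in>C. Metric_space.mcball UNIV d c 1))"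

text \<open>
  Boundaries need not be measurable, hence the outer measure. The sets \<open>A n\<close> must have positive
  measure for the quotient to make sense (in \<open>ennreal\<close>, \<open>0 / 0 = 0\<close>).
\<close>

definition amenable_mms ::
    "('a::topological_space \<Rightarrow> 'a \<Rightarrow> real) \<Rightarrow> 'a measure \<Rightarrow> bool" where
  "amenable_mms d M \<longleftrightarrow>
     (\<exists>A :: nat \<Rightarrow> 'a set.
        (\<forall>n. thick d (A n) \<and> A n \<in> sets M \<and> 0 < emeasure M (A n) \<and> emeasure M (A n) < \<infinity>) \<and>
        (\<forall>R>0. (\<lambda>n. outer_measure_of M (boundary d R (A n)) / emeasure M (A n)) \<longlonglongrightarrow> 0))"


section \<open>Measure-scaling quasi-isometries and the scaling group\<close>

definition quasi_isometry ::
    "('a \<Rightarrow> 'a \<Rightarrow> real) \<Rightarrow> ('b \<Rightarrow> 'b \<Rightarrow> real) \<Rightarrow> ('a \<Rightarrow> 'b) \<Rightarrow> bool" where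
  "quasi_isometry dX dY f \<longleftrightarrow>
     (\<exists>C K :: real. C \<ge> 1 \<and> K \<ge> 0 \<and>
        (\<forall>x y. (1 / C) * dX x y - K \<le> dY (f x) (f y) \<and> dY (f x) (f y) \<le> C * dX x y + K) \<and>
        (\<forall>y. \<exists>x. dY y (f x) \<le> K))"

definition quasi_to_one ::
    "('a::topological_space \<Rightarrow> 'a \<Rightarrow> real) \<Rightarrow> 'a measure \<Rightarrow>
     ('b::topological_space \<Rightarrow> 'b \<Rightarrow> real) \<Rightarrow> 'b measure \<Rightarrow> real \<Rightarrow> ('a \<Rightarrow> 'b) \<Rightarrow> bool" where
  "quasi_to_one dX M dY N \<kappa> f \<longleftrightarrow>
     standard_mms dX M \<and> standard_mms dY N \<and> \<kappa> > 0 \<and> f \<in> measurable M N \<and>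
     (\<exists>C::real. C > 0 \<and>
        (\<forall>A. thick dY A \<and> A \<in> sets N \<and> emeasure N A < \<infinity> \<longrightarrow>
           \<bar>ereal \<kappa> * enn2ereal (emeasure N A) - enn2ereal (emeasure M (f -` A))\<bar>
             \<le> ereal C * enn2ereal (outer_measure_of N (boundary dY 2 A))))"

definition has_scaling_factor ::
    "('a::topological_space \<Rightarrow> 'a \<Rightarrow> real) \<Rightarrow> 'a measure \<Rightarrow>
     ('b::topological_space \<Rightarrow> 'b \<Rightarrow> real) \<Rightarrow> 'b measure \<Rightarrow> ('a \<Rightarrow> 'b) \<Rightarrow> real \<Rightarrow> bool" where
  "has_scaling_factor dX M dY N f \<kappa> \<longleftrightarrow>
     quasi_isometry dX dY f \<and> quasi_to_one dX M dY N \<kappa> f"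

definition measure_scaling_quasi_isometry ::
    "('a::topological_space \<Rightarrow> 'a \<Rightarrow> real) \<Rightarrow> 'a measure \<Rightarrow>
     ('b::topological_space \<Rightarrow> 'b \<Rightarrow> real) \<Rightarrow> 'b measure \<Rightarrow> ('a \<Rightarrow> 'b) \<Rightarrow> bool" where
  "measure_scaling_quasi_isometry dX M dY N f \<longleftrightarrow>
     (\<exists>\<kappa>. has_scaling_factor dX M dY N f \<kappa>)"

text \<open>Only meaningful when the space is standard and amenable.\<close>

definition Sc :: "('a::topological_space \<Rightarrow> 'a \<Rightarrow> real) \<Rightarrow> 'a measure \<Rightarrow> real set" where
  "Sc d M = {\<kappa>. \<exists>f. has_scaling_factor d M d M f \<kappa>}"


section \<open>Locally compact groups\<close>

text \<open>
  Groups are written additively, because the topological groups of the library are; the class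
  \<open>topological_group_add\<close> does not assume commutativity.
\<close>

definition left_haar_measure :: "'g::{topological_group_add, t2_space} measure \<Rightarrow> bool" where
  "left_haar_measure M \<longleftrightarrow>
     sets M = sets borel \<and>
     emeasure M UNIV \<noteq> 0 \<and>
     (\<forall>g. \<forall>A\<in>sets borel. emeasure M ((\<lambda>x. g + x) ` A) = emeasure M A) \<and>
     (\<forall>K. compact K \<longrightarrow> emeasure M K < \<infinity>) \<and>
     (\<forall>A\<in>sets borel. emeasure M A = (INF U\<in>{U. open U \<and> A \<subseteq> U}. emeasure M U)) \<and>
     (\<forall>U. open U \<longrightarrow> emeasure M U = (SUP K\<in>{K. compact K \<and> K \<subseteq> U}. emeasure M K))"

definition compact_generating_set :: "'g::{topological_group_add, t2_space} set \<Rightarrow> bool" where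
  "compact_generating_set S \<longleftrightarrow>
     compact S \<and> uminus ` S = S \<and> interior S \<noteq> {} \<and> (\<forall>g. \<exists>w\<in>lists S. sum_list w = g)"

definition word_length :: "'g::group_add set \<Rightarrow> 'g \<Rightarrow> nat" where
  "word_length S g = (LEAST n. \<exists>w\<in>lists S. length w = n \<and> sum_list w = g)"

text \<open>Left-invariant: the multiplicative form is \<open>d\<^sub>S(x, y) = |x\<^sup>-\<^sup>1 y|\<^sub>S\<close>.\<close>

definition word_metric :: "'g::group_add set \<Rightarrow> 'g \<Rightarrow> 'g \<Rightarrow> real" where
  "word_metric S x y = real (word_length S (- x + y))"

definition group_morphism :: "('g::group_add \<Rightarrow> 'h::group_add) \<Rightarrow> bool" where
  "group_morphism \<phi> \<longleftrightarrow> (\<forall>x y. \<phi> (x + y) = \<phi> x + \<phi> y)"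

definition proper_morphism ::
    "('g::{topological_group_add, t2_space} \<Rightarrow> 'h::{topological_group_add, t2_space}) \<Rightarrow> bool" where
  "proper_morphism \<phi> \<longleftrightarrow> (\<forall>K. compact K \<longrightarrow> compact (\<phi> -` K))"

definition cocompact_morphism ::
    "('g::{topological_group_add, t2_space} \<Rightarrow> 'h::{topological_group_add, t2_space}) \<Rightarrow> bool" where
  "cocompact_morphism \<phi> \<longleftrightarrow> (\<exists>K. compact K \<and> (\<forall>h. \<exists>g. \<exists>k\<in>K. h = \<phi> g + k))"

end

theory Submission
  imports Defs
begin

text \<open>
  The map \<open>\<phi>\<close> pushes \<open>\<mu>G\<close> forward to a measure on \<open>H\<close> that is in general invariant only under left
  translation by \<open>\<phi>(G)\<close>. It has to be compared with \<open>\<mu>H\<close> on every set \<open>A\<close> up to a multiple of the size of the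
  boundary of \<open>A\<close>. Cocompactness and properness provide a function \<open>f \<ge> 0\<close> on \<open>H\<close>, vanishing off a
  word ball of radius \<open>n\<close>, whose integral over every orbit is normalized
  (\<open>bruhat_function\<close>); in multiplicative notation, \<open>\<integral> f(\<phi>(g)\<^sup>-\<^sup>1 h) dg = 1\<close> for all \<open>h\<close>.
  By Tonelli's theorem and left invariance of \<open>\<mu>H\<close>,
    \<open>\<mu>H(A) = \<integral>\<integral> 1\<^sub>A(h) f(\<phi>(g)\<^sup>-\<^sup>1 h) dh dg = \<integral>\<integral> 1\<^sub>A(\<phi>(g) h) f(h) dh dg\<close>.
  If \<open>\<phi>(g)\<close> is not in the boundary of \<open>A\<close> at scale \<open>n\<close>, the inner integral is exactly \<open>c 1\<^sub>A(\<phi>(g))\<close> with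
  \<open>c = \<integral> f\<close>, and it always lies between \<open>0\<close> and \<open>c\<close>. Hence \<open>\<mu>H(A)\<close> and \<open>c \<mu>G(\<phi>\<^sup>-\<^sup>1 A)\<close> differ by at most
  \<open>c\<close> times the measure of the preimage of that boundary, and the scaling factor is \<open>1 / c\<close>
  (\<open>map_scaling_factor\<close>).

  What is left is to replace boundaries at scale \<open>n\<close> by boundaries at scale \<open>2\<close>. A path that leaves \<open>A\<close>
  meets the boundary at scale \<open>1\<close>, so a maximal separated subset of that boundary has
  cardinality controlled by the measure of the boundary at scale \<open>2\<close>, and finitely many balls around its points
  cover the boundary at any other scale (\<open>boundary_cover\<close>). The same covering shows that the
  estimate defining quasi-\<open>\<kappa>\<close>-to-one maps, which is required for thick sets only, holds for all bounded
  measurable sets (\<open>quasi_measure_on_bounded\<close>). Consequently scaling factors multiply under composition and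
  are inverted by measurable quasi-inverses (\<open>has_scaling_factor_compose\<close>,
  \<open>has_scaling_factor_quasi_inverse\<close>). If \<open>\<psi>\<close> is a measurable quasi-inverse of \<open>\<phi>\<close>, then
  \<open>f \<mapsto> \<psi> \<circ> f \<circ> \<phi>\<close> and \<open>f \<mapsto> \<phi> \<circ> f \<circ> \<psi>\<close> preserve the scaling factor of a self-map, whence the equality of the
  scaling groups.

  The topologies need not be second countable, so a Borel set of a product of groups may fail
  to belong to the product of the Borel \<open>\<sigma>\<close>-algebras. Tonelli's theorem is therefore only applied to
  integrands built from a continuous function on the product and from functions of one variable;
  compactly generated groups are \<open>\<sigma>\<close>-compact, and this makes such continuous functions measurable
  (\<open>pair_measurable_continuous\<close>).
\<close>

section \<open>Closeness up to an additive error\<close>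

abbreviation dball :: "('a \<Rightarrow> 'a \<Rightarrow> real) \<Rightarrow> 'a \<Rightarrow> real \<Rightarrow> 'a set" where
  "dball d x r \<equiv> {y. d x y \<le> r}"

lemma mcball_eq_dball: "Metric_space UNIV d \<Longrightarrow> Metric_space.mcball UNIV d x r = dball d x r"
  by (auto simp: Metric_space.mcball_def)

text \<open>
  A symmetric estimate without subtraction remains meaningful when the sizes or the error are infinite.
\<close>

definition close_upto :: "ennreal \<Rightarrow> ennreal \<Rightarrow> ennreal \<Rightarrow> bool" where
  "close_upto a b e \<longleftrightarrow> a \<le> b + e \<and> b \<le> a + e"

lemma close_upto_sym: "close_upto a b e \<Longrightarrow> close_upto b a e"
  by (auto simp: close_upto_def)

lemma close_upto_mono: "close_upto a b e \<Longrightarrow> e \<le> e' \<Longrightarrow> close_upto a b e'"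
  unfolding close_upto_def by (meson add_left_mono order_trans)

lemma close_upto_trans:
  assumes "close_upto a b e" "close_upto b c e'" shows "close_upto a c (e + e')"
proof -
  have "a \<le> (c + e') + e" "c \<le> (a + e) + e'"
    using assms unfolding close_upto_def by (meson add_right_mono order_trans)+
  then show ?thesis by (auto simp: close_upto_def ac_simps)
qed

lemma close_upto_mult: "close_upto a b e \<Longrightarrow> close_upto (k * a) (k * b) (k * e)"
  unfolding close_upto_def by (metis distrib_left mult_left_mono zero_le)

lemma close_upto_trans_const:
  assumes "close_upto a b (ennreal p * e)" "close_upto b c (ennreal q * e)" "p \<ge> 0" "q \<ge> 0"
  shows "close_upto a c (ennreal (p + q) * e)"
  using close_upto_trans[OF assms(1,2)] assms(3,4) by (simp add: ennreal_plus distrib_right)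

lemma close_upto_emeasure:
  assumes "A \<in> sets M" "B \<in> sets M" "W \<in> sets M" "A - B \<subseteq> W" "B - A \<subseteq> W"
  shows "close_upto (emeasure M A) (emeasure M B) (emeasure M W)"
proof -
  have "emeasure M A \<le> emeasure M (B \<union> W)" "emeasure M B \<le> emeasure M (A \<union> W)"
    using assms by (auto intro!: emeasure_mono)
  then show ?thesis
    unfolding close_upto_def using assms by (meson emeasure_subadditive order_trans)
qed

lemma abs_ereal_le_iff_close_upto:
  assumes "a < \<infinity>"
  shows "\<bar>enn2ereal a - enn2ereal b\<bar> \<le> enn2ereal e \<longleftrightarrow> close_upto a b e"
proof (cases a)
  case [simp]: (real a')
  show ?thesis
  proof (cases b)
    case [simp]: (real b')
    show ?thesis
    proof (cases e)
      case [simp]: (real e')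
      show ?thesis
        by (auto simp: close_upto_def simp flip: ennreal_plus)
    qed (auto simp: close_upto_def)
  next
    case [simp]: top
    show ?thesis by (cases e) (auto simp: close_upto_def top_unique simp flip: ennreal_plus)
  qed
qed (use assms in auto)

text \<open>
  The inequality required of quasi-\<open>\<kappa>\<close>-to-one maps, for a single set.
\<close>

definition quasi_measure_on ::
    "('a \<Rightarrow> 'b) \<Rightarrow> 'a measure \<Rightarrow> ('b \<Rightarrow> 'b \<Rightarrow> real) \<Rightarrow> 'b measure \<Rightarrow> real \<Rightarrow> real \<Rightarrow> 'b set \<Rightarrow> bool" where
  "quasi_measure_on f M d N \<kappa> C A \<longleftrightarrow>
     close_upto (ennreal \<kappa> * emeasure N A) (emeasure M (f -` A))
       (ennreal C * outer_measure_of N (boundary d 2 A))"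

lemma quasi_to_one_iff:
  "quasi_to_one dX M dY N \<kappa> f \<longleftrightarrow>
     standard_mms dX M \<and> standard_mms dY N \<and> \<kappa> > 0 \<and> f \<in> measurable M N \<and>
     (\<exists>C>0. \<forall>A. thick dY A \<and> A \<in> sets N \<and> emeasure N A < \<infinity> \<longrightarrow> quasi_measure_on f M dY N \<kappa> C A)"
proof -
  have *: "\<bar>ereal \<kappa> * enn2ereal (emeasure N A) - enn2ereal (emeasure M (f -` A))\<bar>
             \<le> ereal C * enn2ereal (outer_measure_of N (boundary dY 2 A))
         \<longleftrightarrow> quasi_measure_on f M dY N \<kappa> C A"
    if "\<kappa> > 0" "C > 0" "emeasure N A < \<infinity>" for A C
  proof -
    have "ereal \<kappa> * enn2ereal (emeasure N A) = enn2ereal (ennreal \<kappa> * emeasure N A)"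
      "ereal C * enn2ereal (outer_measure_of N (boundary dY 2 A))
        = enn2ereal (ennreal C * outer_measure_of N (boundary dY 2 A))"
      using that by (simp_all add: times_ennreal.rep_eq enn2ereal_ennreal)
    moreover have "ennreal \<kappa> * emeasure N A < \<infinity>"
      using that by (simp add: ennreal_mult_less_top)
    ultimately show ?thesis
      using abs_ereal_le_iff_close_upto by (simp add: quasi_measure_on_def)
  qed
  show ?thesis
    unfolding quasi_to_one_def using * by meson
qed

lemma has_scaling_factorI:
  assumes "standard_mms dX M" "standard_mms dY N" "quasi_isometry dX dY f" "f \<in> measurable M N"
    and "\<kappa> > 0" "C > 0"
    and "\<And>A. thick dY A \<Longrightarrow> A \<in> sets N \<Longrightarrow> emeasure N A < \<infinity> \<Longrightarrow> quasi_measure_on f M dY N \<kappa> C A"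
  shows "has_scaling_factor dX M dY N f \<kappa>"
  unfolding has_scaling_factor_def quasi_to_one_iff using assms by blast

section \<open>Boundaries in integer-valued standard spaces\<close>

text \<open>
  Word metrics are integer-valued. This makes distances to sets attained and, with the path axiom,
  makes every ball of radius at least 1 a union of balls of radius 1, so that bounded sets have
  measurable thick neighbourhoods.
\<close>

locale integral_mms =
  fixes d :: "'a::topological_space \<Rightarrow> 'a \<Rightarrow> real" and M :: "'a measure"
  assumes standard: "standard_mms d M"
    and integral: "d x y \<in> \<nat>"
begin

lemma metric: "Metric_space UNIV d"
  using standard by (auto simp: standard_mms_def metric_measure_space_def)

lemma zero [simp]: "d x x = 0" and sym: "d x y = d y x" and nonneg: "d x y \<ge> 0"
  and triangle: "d x z \<le> d x y + d y z"
  using metric by (auto simp: Metric_space_def)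

lemma thick_iff: "thick d A \<longleftrightarrow> (\<exists>C. A = (\<Union>c\<in>C. dball d c 1))"
  by (simp add: thick_def mcball_eq_dball[OF metric])

lemma space [simp]: "space M = UNIV" and sets: "sets M = sets borel"
  using standard sets_eq_imp_space_eq[of M borel]
  by (auto simp: standard_mms_def metric_measure_space_def)

lemma ball_measurable [measurable, simp]: "dball d x r \<in> sets M"
proof -
  have [measurable]: "(\<lambda>(x, y). d x y) \<in> borel_measurable (borel :: ('a \<times> 'a) measure)"
    using standard by (auto simp: standard_mms_def metric_measure_space_def)
  have "(\<lambda>y. (x, y)) \<in> borel \<rightarrow>\<^sub>M borel"
    by (intro borel_measurable_continuous_onI continuous_intros)
  from measurable_compose[OF this, of "\<lambda>(x, y). d x y" borel]
  have [measurable]: "(\<lambda>y. d x y) \<in> borel_measurable borel" by simp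
  show ?thesis unfolding sets by simp
qed

lemma volume_bounds:
  assumes "r \<ge> 1"
  shows "\<exists>v>0. \<forall>x. ennreal v \<le> emeasure M (dball d x r)" "\<exists>V>0. \<forall>x. emeasure M (dball d x r) \<le> ennreal V"
proof -
  obtain v V where "0 < v" "v \<le> V" "\<forall>x. ennreal v \<le> emeasure M (dball d x r) \<and>
      emeasure M (dball d x r) \<le> ennreal V"
    using standard assms by (force simp: standard_mms_def mcball_eq_dball[OF metric])
  then show "\<exists>v>0. \<forall>x. ennreal v \<le> emeasure M (dball d x r)" "\<exists>V>0. \<forall>x. emeasure M (dball d x r) \<le> ennreal V"
    by (auto intro: less_le_trans)
qed

lemma path:
  obtains z and n :: nat where "z 0 = x" "z n = y" "\<And>i. i \<in> {1..n} \<Longrightarrow> d (z (i - 1)) (z i) \<le> 1"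
    "d x y = (\<Sum>i=1..n. d (z (i - 1)) (z i))"
proof -
  have "\<exists>(n::nat) z. z 0 = x \<and> z n = y \<and> (\<forall>i\<in>{1..n}. d (z (i - 1)) (z i) \<le> 1) \<and>
      d x y = (\<Sum>i=1..n. d (z (i - 1)) (z i))"
    using standard unfolding standard_mms_def by blast
  then show thesis using that by blast
qed

lemma path_prefix: "d (z 0) (z (n::nat)) \<le> (\<Sum>i=1..n. d (z (i - 1)) (z i))"
proof (induction n)
  case (Suc n)
  have "d (z 0) (z (Suc n)) \<le> d (z 0) (z n) + d (z n) (z (Suc n))" by (rule triangle)
  then show ?case using Suc by simp
qed simp

text \<open>
  A set of integers bounded below has a minimum, so that an infimum at most \<open>R\<close> is
  attained; the empty set gives the infimum \<open>\<infinity>\<close> and matches the empty existential.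
\<close>

lemma nbhd_eq: "nbhd d R A = {x. \<exists>a\<in>A. d x a \<le> R}"
proof (intro set_eqI iffI)
  fix x assume "x \<in> nbhd d R A"
  then have "(INF a\<in>A. ereal (d x a)) \<le> ereal R" by (simp add: nbhd_def)
  also have "\<dots> < ereal (of_int (\<lfloor>R\<rfloor> + 1))" by simp
  finally obtain a where a: "a \<in> A" "d x a < of_int (\<lfloor>R\<rfloor> + 1)"
    by (auto simp: INF_less_iff)
  from integral[of x a] obtain k :: nat where k: "d x a = real k" by (auto elim: Nats_cases)
  from a have "int k \<le> \<lfloor>R\<rfloor>" unfolding k by linarith
  then have "d x a \<le> R" unfolding k by linarith
  with a show "x \<in> {x. \<exists>a\<in>A. d x a \<le> R}" by blast
qed (auto simp: nbhd_def intro: INF_lower2)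

lemma mem_boundary: "x \<in> boundary d R A \<longleftrightarrow> (\<exists>a\<in>A. d x a \<le> R) \<and> (\<exists>b. b \<notin> A \<and> d x b \<le> R)"
  by (auto simp: boundary_def nbhd_eq)

text \<open>
  A path to a point \<open>y\<close> of the ball enters \<open>y\<close> from a point at distance exactly 1, which is one step
  closer to the centre; the unit ball around that point stays inside.
\<close>

lemma ball_thick:
  assumes "r \<ge> 1" shows "thick d (dball d x r)"
proof -
  have "\<exists>c. dball d c 1 \<subseteq> dball d x r \<and> y \<in> dball d c 1" if y: "y \<in> dball d x r" for y
  proof -
    obtain z and n :: nat where z: "z 0 = x" "z n = y"
      "\<And>i. i \<in> {1..n} \<Longrightarrow> d (z (i - 1)) (z i) \<le> 1" "d x y = (\<Sum>i=1..n. d (z (i - 1)) (z i))"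
      by (rule path[of x y]) (rule that)
    show ?thesis
    proof (cases "y = x")
      case True
      then show ?thesis using assms by (intro exI[of _ x]) auto
    next
      case False
      \<comment> \<open>Steps may have length 0; the step that first reaches \<open>y\<close> starts elsewhere and has length exactly 1.\<close>
      define k where "k = (LEAST k. z k = y)"
      have "z k = y" unfolding k_def using z(2) by (rule LeastI)
      have "k \<le> n" unfolding k_def using z(2) by (rule Least_le)
      have "k \<noteq> 0" using False \<open>z k = y\<close> z(1) by (metis)
      have "z (k - 1) \<noteq> y"
        using not_less_Least[of "k - 1" "\<lambda>k. z k = y"] \<open>k \<noteq> 0\<close> by (auto simp: k_def)
      let ?w = "z (k - 1)"
      have "d ?w y \<noteq> 0" using metric \<open>?w \<noteq> y\<close> by (auto simp: Metric_space_def)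
      moreover have "d ?w y \<le> 1" using z(3)[of k] \<open>k \<le> n\<close> \<open>k \<noteq> 0\<close> \<open>z k = y\<close> by auto
      ultimately have "d ?w y = 1" using integral[of ?w y] by (auto elim!: Nats_cases)
      have "d x ?w + 1 \<le> (\<Sum>i=1..k-1. d (z (i - 1)) (z i)) + d ?w (z k)"
        using path_prefix[of z "k - 1"] z(1) \<open>d ?w y = 1\<close> \<open>z k = y\<close> by simp
      also have "\<dots> = (\<Sum>i=1..k. d (z (i - 1)) (z i))"
        using \<open>k \<noteq> 0\<close> by (cases k) auto
      also have "\<dots> \<le> d x y"
        unfolding z(4) using \<open>k \<le> n\<close> by (intro sum_mono2) (auto simp: nonneg)
      finally have "d x ?w + 1 \<le> r" using y by auto
      then have "dball d ?w 1 \<subseteq> dball d x r"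
        using triangle[of x _ ?w] by (smt (verit) mem_Collect_eq subsetI)
      then show ?thesis using \<open>d ?w y \<le> 1\<close> by blast
    qed
  qed
  then have "dball d x r = (\<Union>c\<in>{c. dball d c 1 \<subseteq> dball d x r}. dball d c 1)"
    by blast
  then show ?thesis unfolding thick_iff by blast
qed

lemma thick_UN: "(\<And>z. z \<in> F \<Longrightarrow> thick d (A z)) \<Longrightarrow> thick d (\<Union>z\<in>F. A z)"
proof -
  assume "\<And>z. z \<in> F \<Longrightarrow> thick d (A z)"
  then obtain C where "\<And>z. z \<in> F \<Longrightarrow> A z = (\<Union>c\<in>C z. dball d c 1)"
    unfolding thick_iff by metis
  then have "(\<Union>z\<in>F. A z) = (\<Union>c\<in>(\<Union>z\<in>F. C z). dball d c 1)" by auto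
  then show ?thesis unfolding thick_iff by blast
qed

text \<open>
  Unit balls around points at mutual distance more than 2 are disjoint. The measure of the unit
  neighbourhood thus bounds the size of separated subsets, and a separated subset of maximal size is a net.
\<close>

lemma separated_net:
  assumes fin: "outer_measure_of M (\<Union>e\<in>E. dball d e 1) < \<infinity>"
    and v: "v > 0" "\<And>x. ennreal v \<le> emeasure M (dball d x 1)"
  obtains F where "finite F" "F \<subseteq> E" "E \<subseteq> (\<Union>z\<in>F. dball d z 2)"
    "ennreal v * of_nat (card F) \<le> outer_measure_of M (\<Union>e\<in>E. dball d e 1)"
proof -
  let ?m = "outer_measure_of M (\<Union>e\<in>E. dball d e 1)"
  define P where "P F \<longleftrightarrow> finite F \<and> F \<subseteq> E \<and> (\<forall>x\<in>F. \<forall>y\<in>F. x \<noteq> y \<longrightarrow> d x y > 2)" for F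
  have card: "ennreal v * of_nat (card F) \<le> ?m" if "P F" for F
  proof -
    have F: "finite F" "F \<subseteq> E" using that by (auto simp: P_def)
    have "disjoint_family_on (\<lambda>z. dball d z 1) F"
      unfolding disjoint_family_on_def
    proof (intro ballI impI)
      fix x y assume "x \<in> F" "y \<in> F" "x \<noteq> y"
      then have "d x y > 2" using that by (auto simp: P_def)
      then show "dball d x 1 \<inter> dball d y 1 = {}"
        using triangle[of x y] sym[of y] by (smt (verit) Collect_empty_eq Int_def mem_Collect_eq)
    qed
    then have "emeasure M (\<Union>z\<in>F. dball d z 1) = (\<Sum>z\<in>F. emeasure M (dball d z 1))"
      using F by (intro sum_emeasure[symmetric]) auto
    moreover have "(\<Sum>z\<in>F. emeasure M (dball d z 1)) \<ge> (\<Sum>z\<in>F. ennreal v)"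
      by (intro sum_mono v)
    moreover have "emeasure M (\<Union>z\<in>F. dball d z 1) \<le> ?m"
    proof -
      have "(\<Union>z\<in>F. dball d z 1) \<in> sets M" using F by auto
      then have "emeasure M (\<Union>z\<in>F. dball d z 1) = outer_measure_of M (\<Union>z\<in>F. dball d z 1)" by simp
      also have "\<dots> \<le> ?m" using F by (intro outer_measure_of_mono) blast
      finally show ?thesis .
    qed
    ultimately show ?thesis by (simp add: mult.commute)
  qed
  have bound: "card F \<le> nat \<lceil>enn2real ?m / v\<rceil>" if "P F" for F
  proof -
    have "ennreal (v * real (card F)) \<le> ennreal (enn2real ?m)"
      using card[OF that] fin v(1) by (simp add: ennreal_mult ennreal_of_nat_eq_real_of_nat)
    then have "v * real (card F) \<le> enn2real ?m" by (subst (asm) ennreal_le_iff) auto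
    then have "real (card F) \<le> enn2real ?m / v" using v(1) by (simp add: field_simps)
    then show ?thesis by linarith
  qed
  have "P {}" by (simp add: P_def)
  moreover have "\<forall>F. P F \<longrightarrow> card F < Suc (nat \<lceil>enn2real ?m / v\<rceil>)"
    using bound by (simp add: less_Suc_eq_le)
  ultimately have "\<exists>F. P F \<and> (\<forall>F'. P F' \<longrightarrow> card F' \<le> card F)"
    by (rule Lattices_Big.ex_has_greatest_nat)
  then obtain F where F: "P F" "\<And>F'. P F' \<Longrightarrow> card F' \<le> card F" by blast
  have "E \<subseteq> (\<Union>z\<in>F. dball d z 2)"
  proof
    fix e assume "e \<in> E"
    show "e \<in> (\<Union>z\<in>F. dball d z 2)"
    proof (rule ccontr)
      assume "\<not> ?thesis"
      then have far: "\<And>z. z \<in> F \<Longrightarrow> d z e > 2" by force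
      then have "e \<notin> F" by force
      have "P (insert e F)"
        using F(1) far \<open>e \<in> E\<close> sym[of e] unfolding P_def by auto
      from F(2)[OF this] show False using \<open>e \<notin> F\<close> F(1) by (simp add: P_def)
    qed
  qed
  then show thesis using that[of F] F(1) card[OF F(1)] by (auto simp: P_def)
qed

text \<open>
  The two points where a path crosses from one side of \<open>A\<close> to the other are within distance 1 of both sides.
\<close>

lemma boundary_near_boundary_1:
  assumes "x \<in> boundary d R A" shows "\<exists>w\<in>boundary d 1 A. d x w \<le> R"
proof -
  \<comment> \<open>Walk from \<open>x\<close> to a point on the other side of \<open>A\<close> and stop at the crossing.\<close>
  obtain a b where "a \<in> A" "d x a \<le> R" "b \<notin> A" "d x b \<le> R"
    using assms unfolding mem_boundary by blast
  then obtain y where y: "d x y \<le> R" "(x \<in> A) \<noteq> (y \<in> A)"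
    by (metis (full_types))
  obtain z and n :: nat where z: "z 0 = x" "z n = y"
    "\<And>i. i \<in> {1..n} \<Longrightarrow> d (z (i - 1)) (z i) \<le> 1" "d x y = (\<Sum>i=1..n. d (z (i - 1)) (z i))"
    by (rule path[of x y]) (rule that)
  define k where "k = (LEAST k. (z k \<in> A) = (y \<in> A))"
  have k: "(z k \<in> A) = (y \<in> A)" "k \<le> n"
    unfolding k_def using z(2) LeastI[of "\<lambda>k. (z k \<in> A) = (y \<in> A)" n]
      Least_le[of "\<lambda>k. (z k \<in> A) = (y \<in> A)" n] by simp_all
  have "k \<noteq> 0" using k(1) y(2) z(1) by metis
  then have "(z (k - 1) \<in> A) \<noteq> (y \<in> A)"
    using not_less_Least[of "k - 1" "\<lambda>k. (z k \<in> A) = (y \<in> A)"] by (auto simp: k_def)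
  then have "z k \<in> boundary d 1 A"
    unfolding mem_boundary using z(3)[of k] k \<open>k \<noteq> 0\<close> sym[of "z k"]
    by (metis One_nat_def Suc_leI atLeastAtMost_iff bot_nat_0.not_eq_extremum zero zero_less_one_class.zero_le_one)
  moreover have "d x (z k) \<le> (\<Sum>i=1..k. d (z (i - 1)) (z i))"
    using path_prefix[of z k] z(1) by simp
  moreover have "(\<Sum>i=1..k. d (z (i - 1)) (z i)) \<le> d x y"
    unfolding z(4) using k(2) by (intro sum_mono2) (auto simp: nonneg)
  ultimately show ?thesis using y(1) by (intro bexI[of _ "z k"]) auto
qed

lemma bounded_finite_measure:
  assumes "r \<ge> 1" shows "emeasure M (dball d x r) < \<infinity>"
  using volume_bounds(2)[OF assms] by (metis ennreal_less_top infinity_ennreal_def le_less_trans)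

text \<open>
  The centres of the unit balls that make up \<open>A\<close> have a finite net, because \<open>A\<close> is their unit neighbourhood.
\<close>

lemma thick_finite_imp_bounded:
  assumes "thick d A" "A \<in> sets M" "emeasure M A < \<infinity>"
  obtains x r where "A \<subseteq> dball d x r"
proof -
  obtain C where C: "A = (\<Union>c\<in>C. dball d c 1)" using assms(1) by (auto simp: thick_iff)
  obtain v where v: "0 < v" "\<And>x. ennreal v \<le> emeasure M (dball d x 1)"
    using volume_bounds(1)[of 1] by auto
  have fin: "outer_measure_of M (\<Union>e\<in>C. dball d e 1) < \<infinity>" using assms(2,3) C by simp
  obtain F where F: "finite F" "C \<subseteq> (\<Union>z\<in>F. dball d z 2)"
    by (rule separated_net[OF fin v]) (rule that)
  fix x0
  have "A \<subseteq> dball d x0 (Max (insert 0 (d x0 ` F)) + 3)"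
  proof
    fix a assume "a \<in> A"
    then obtain c z where "c \<in> C" "d c a \<le> 1" "z \<in> F" "d z c \<le> 2"
      using C F by blast
    moreover from this have "d x0 z \<le> Max (insert 0 (d x0 ` F))" using F by auto
    ultimately show "a \<in> dball d x0 (Max (insert 0 (d x0 ` F)) + 3)"
      using triangle[of x0 a z] triangle[of z a c] by simp
  qed
  then show thesis using that by blast
qed

end

section \<open>Boundaries under quasi-isometries\<close>

lemma quasi_isometry_preimage_ball:
  assumes "integral_mms dX M" "integral_mms dY N" "quasi_isometry dX dY f"
  obtains s where "s \<ge> 1" "\<And>y. \<exists>x. f -` dball dY y r \<subseteq> dball dX x s"
proof -
  interpret X: integral_mms dX M by fact
  interpret Y: integral_mms dY N by fact
  obtain C K where CK: "C \<ge> 1" "K \<ge> 0" "\<And>x y. (1 / C) * dX x y - K \<le> dY (f x) (f y)"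
    using assms(3) unfolding quasi_isometry_def by blast
  define s where "s = max 1 (C * (2 * r + K))"
  have "\<exists>x. f -` dball dY y r \<subseteq> dball dX x s" for y
  proof (cases "f -` dball dY y r = {}")
    case False
    then obtain x where x: "dY y (f x) \<le> r" by auto
    have "dX x x' \<le> s" if "dY y (f x') \<le> r" for x'
    proof -
      have "(1 / C) * dX x x' \<le> 2 * r + K"
        using CK(3)[of x x'] Y.triangle[of "f x" "f x'" y] Y.sym[of "f x" y] x that by linarith
      then have "dX x x' \<le> C * (2 * r + K)" using CK(1) by (simp add: field_simps)
      then show ?thesis by (simp add: s_def)
    qed
    then show ?thesis by blast
  qed simp
  moreover have "s \<ge> 1" by (simp add: s_def)
  ultimately show thesis using that by blast
qed

text \<open>
  Take a net \<open>F\<close> of the boundary at scale 1. Its size is controlled by the boundary at scale 2, which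
  contains the unit balls around \<open>F\<close>. The boundary at scale \<open>R\<close> lies within \<open>R + 2\<close> of \<open>F\<close>, and
  preimages of balls of that radius have bounded measure. The measurable cover \<open>W\<close> is used in place
  of the boundary, which need not be measurable itself. When the boundary at scale 2 has infinite
  outer measure, the whole space serves as \<open>W\<close>.
\<close>

lemma boundary_cover:
  assumes "integral_mms dX M" "integral_mms dY N" "quasi_isometry dX dY f"
  shows "\<exists>c>0. \<forall>A. \<exists>W\<in>sets N. boundary dY R A \<subseteq> W \<and>
    emeasure M (f -` W) \<le> ennreal c * outer_measure_of N (boundary dY 2 A)"
proof -
  interpret X: integral_mms dX M by fact
  interpret Y: integral_mms dY N by fact
  obtain v where v: "0 < v" "\<And>x. ennreal v \<le> emeasure N (dball dY x 1)"
    using Y.volume_bounds(1)[of 1] by auto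
  obtain s where s: "s \<ge> 1" "\<And>y. \<exists>x. f -` dball dY y (R + 2) \<subseteq> dball dX x s"
    using quasi_isometry_preimage_ball[OF assms] by metis
  obtain V where V: "0 < V" "\<And>x. emeasure M (dball dX x s) \<le> ennreal V"
    using X.volume_bounds(2)[OF s(1)] by blast
  have ball: "emeasure M (f -` dball dY y (R + 2)) \<le> ennreal V" for y
  proof -
    obtain x where "f -` dball dY y (R + 2) \<subseteq> dball dX x s" using s(2) by blast
    then have "emeasure M (f -` dball dY y (R + 2)) \<le> emeasure M (dball dX x s)"
      by (rule emeasure_mono) simp
    then show ?thesis using V(2) order_trans by blast
  qed
  have "\<exists>W\<in>sets N. boundary dY R A \<subseteq> W \<and>
      emeasure M (f -` W) \<le> ennreal (V / v) * outer_measure_of N (boundary dY 2 A)" for A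
  proof (cases "outer_measure_of N (boundary dY 2 A) < \<infinity>")
    case False
    then have "outer_measure_of N (boundary dY 2 A) = top" by (simp add: less_top[symmetric])
    then show ?thesis using v(1) V(1) by (intro bexI[of _ UNIV]) (auto simp: Y.sets ennreal_mult_top)
  next
    case True
    let ?E = "boundary dY 1 A"
    have "(\<Union>e\<in>?E. dball dY e 1) \<subseteq> boundary dY 2 A"
    proof clarify
      fix x e assume "e \<in> ?E" "dY e x \<le> 1"
      then show "x \<in> boundary dY 2 A"
        unfolding Y.mem_boundary using Y.triangle[of x _ e] Y.sym[of x e] by (smt (verit))
    qed
    then have le: "outer_measure_of N (\<Union>e\<in>?E. dball dY e 1) \<le> outer_measure_of N (boundary dY 2 A)"
      by (rule outer_measure_of_mono)
    have fin: "outer_measure_of N (\<Union>e\<in>?E. dball dY e 1) < \<infinity>"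
      using le True by (rule le_less_trans)
    obtain F where F: "finite F" "F \<subseteq> ?E" "?E \<subseteq> (\<Union>z\<in>F. dball dY z 2)"
      "ennreal v * of_nat (card F) \<le> outer_measure_of N (\<Union>e\<in>?E. dball dY e 1)"
      using Y.separated_net[OF fin v] .
    define W where "W = (\<Union>z\<in>F. dball dY z (R + 2))"
    have "boundary dY R A \<subseteq> W"
    proof
      fix x assume "x \<in> boundary dY R A"
      then obtain w where "w \<in> ?E" "dY x w \<le> R" using Y.boundary_near_boundary_1 by blast
      moreover from this obtain z where "z \<in> F" "dY z w \<le> 2" using F(3) by blast
      ultimately show "x \<in> W"
        unfolding W_def using Y.triangle[of z x w] Y.sym[of x w] by force
    qed
    moreover have "emeasure M (f -` W) \<le> ennreal (V / v) * outer_measure_of N (boundary dY 2 A)"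
    proof -
      obtain x where x: "\<And>y. f -` dball dY y (R + 2) \<subseteq> dball dX (x y) s" using s(2) by metis
      have "emeasure M (f -` W) \<le> emeasure M (\<Union>z\<in>F. dball dX (x z) s)"
        using x F(1) unfolding W_def by (intro emeasure_mono) auto
      also have "\<dots> \<le> (\<Sum>z\<in>F. emeasure M (dball dX (x z) s))"
        using F(1) by (intro emeasure_subadditive_finite) auto
      also have "\<dots> \<le> (\<Sum>z\<in>F. ennreal V)" by (intro sum_mono V)
      also have "\<dots> = ennreal (V / v) * (ennreal v * of_nat (card F))"
        using V v by (simp add: mult.assoc[symmetric] ennreal_mult[symmetric] mult.commute)
      also have "\<dots> \<le> ennreal (V / v) * outer_measure_of N (boundary dY 2 A)"
        using order_trans[OF F(4) le] by (intro mult_left_mono) auto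
      finally show ?thesis .
    qed
    moreover have "W \<in> sets N" unfolding W_def using F(1) by auto
    ultimately show ?thesis by blast
  qed
  then show ?thesis using v V by (intro exI[of _ "V / v"]) auto
qed

lemma quasi_isometry_id:
  "integral_mms d M \<Longrightarrow> quasi_isometry d d (\<lambda>x. x)"
  unfolding quasi_isometry_def using integral_mms.zero
  by (metis diff_zero div_by_1 dual_order.refl mult_1 add.right_neutral zero_less_one_class.zero_le_one le_numeral_extra(4))

lemma boundary_outer_measure_le:
  assumes "integral_mms d M"
  shows "\<exists>c>0. \<forall>A. outer_measure_of M (boundary d R A) \<le> ennreal c * outer_measure_of M (boundary d 2 A)"
proof -
  obtain c where c: "c > 0" "\<And>A. \<exists>W\<in>sets M. boundary d R A \<subseteq> W \<and>
    emeasure M ((\<lambda>x. x) -` W) \<le> ennreal c * outer_measure_of M (boundary d 2 A)"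
    using boundary_cover[OF assms assms quasi_isometry_id[OF assms]] by metis
  have "outer_measure_of M (boundary d R A) \<le> ennreal c * outer_measure_of M (boundary d 2 A)" for A
  proof -
    obtain W where "W \<in> sets M" "boundary d R A \<subseteq> W"
      "emeasure M W \<le> ennreal c * outer_measure_of M (boundary d 2 A)" using c(2)[of A] by auto
    then show ?thesis using outer_measure_of_mono[of "boundary d R A" W M] by simp
  qed
  then show ?thesis using c(1) by blast
qed

text \<open>
  Points at distance at most 2 have images at distance at most \<open>2 C + K\<close>, so the boundary of a preimage maps
  into a boundary at that larger scale.
\<close>

lemma boundary_vimage_outer_measure_le:
  assumes "integral_mms dX M" "integral_mms dY N" "quasi_isometry dX dY f" "f \<in> measurable M N"
  shows "\<exists>c>0. \<forall>A. outer_measure_of M (boundary dX 2 (f -` A))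
    \<le> ennreal c * outer_measure_of N (boundary dY 2 A)"
proof -
  interpret X: integral_mms dX M by fact
  interpret Y: integral_mms dY N by fact
  obtain C K where CK: "C \<ge> 1" "\<And>x y. dY (f x) (f y) \<le> C * dX x y + K"
    using assms(3) unfolding quasi_isometry_def by blast
  define R where "R = 2 * C + K"
  obtain c where c: "c > 0" "\<And>A. \<exists>W\<in>sets N. boundary dY R A \<subseteq> W \<and>
    emeasure M (f -` W) \<le> ennreal c * outer_measure_of N (boundary dY 2 A)"
    using boundary_cover[OF assms(1-3)] by metis
  have "outer_measure_of M (boundary dX 2 (f -` A)) \<le> ennreal c * outer_measure_of N (boundary dY 2 A)" for A
  proof -
    obtain W where W: "W \<in> sets N" "boundary dY R A \<subseteq> W"
      "emeasure M (f -` W) \<le> ennreal c * outer_measure_of N (boundary dY 2 A)" using c(2)[of A] by auto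
    have le: "dY (f x) (f y) \<le> R" if "dX x y \<le> 2" for x y
    proof -
      have "C * dX x y \<le> C * 2" using that CK(1) by (intro mult_left_mono) auto
      then show ?thesis using CK(2)[of x y] by (simp add: R_def)
    qed
    have "f x \<in> boundary dY R A" if "x \<in> boundary dX 2 (f -` A)" for x
      using that unfolding X.mem_boundary Y.mem_boundary by (auto intro!: le)
    then have "boundary dX 2 (f -` A) \<subseteq> f -` W" using W(2) by blast
    moreover have "f -` W \<in> sets M" using measurable_sets[OF assms(4) W(1)] by simp
    ultimately show ?thesis
      using outer_measure_of_mono[of "boundary dX 2 (f -` A)" "f -` W" M] W(3) by simp
  qed
  then show ?thesis using c(1) by blast
qed

section \<open>Composition and inversion of scaling factors\<close>

text \<open>
  Preimages of thick sets are in general not thick, which would block composition. A bounded set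
  \<open>B\<close> is therefore replaced by the union \<open>B'\<close> of the balls of radius 2 around a finite net of \<open>B\<close>:
  \<open>B'\<close> is thick and measurable, contains \<open>B\<close> and exceeds it only inside the boundary of \<open>B\<close>.
  Its own boundary at scale 2 lies in the boundary of \<open>B\<close> at scale 4.
\<close>

lemma quasi_measure_on_bounded:
  assumes X: "integral_mms dX M" and Y: "integral_mms dY N" and f: "has_scaling_factor dX M dY N f \<kappa>"
  shows "\<exists>C>0. \<forall>B\<in>sets N. (\<exists>y r. B \<subseteq> dball dY y r) \<longrightarrow> quasi_measure_on f M dY N \<kappa> C B"
proof -
  interpret X: integral_mms dX M by fact
  interpret Y: integral_mms dY N by fact
  obtain C where C: "C > 0" "\<And>A. thick dY A \<Longrightarrow> A \<in> sets N \<Longrightarrow> emeasure N A < \<infinity> \<Longrightarrow>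
      quasi_measure_on f M dY N \<kappa> C A" and meas: "f \<in> measurable M N" and "\<kappa> > 0"
    and qi: "quasi_isometry dX dY f"
    using f unfolding has_scaling_factor_def quasi_to_one_iff by blast
  obtain c1 where c1: "c1 > 0" "\<And>A. \<exists>W\<in>sets N. boundary dY 2 A \<subseteq> W \<and>
    emeasure N ((\<lambda>x. x) -` W) \<le> ennreal c1 * outer_measure_of N (boundary dY 2 A)"
    using boundary_cover[OF Y Y quasi_isometry_id[OF Y]] by metis
  obtain c2 where c2: "c2 > 0" "\<And>A. \<exists>W\<in>sets N. boundary dY 2 A \<subseteq> W \<and>
    emeasure M (f -` W) \<le> ennreal c2 * outer_measure_of N (boundary dY 2 A)"
    using boundary_cover[OF X Y qi] by metis
  obtain c4 where c4: "c4 > 0"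
    "\<And>A. outer_measure_of N (boundary dY 4 A) \<le> ennreal c4 * outer_measure_of N (boundary dY 2 A)"
    using boundary_outer_measure_le[OF Y, of 4] by metis
  have "quasi_measure_on f M dY N \<kappa> (\<kappa> * c1 + C * c4 + c2) B"
    if B: "B \<in> sets N" and bdd: "B \<subseteq> dball dY y r" for B y r
  proof -
    let ?e = "outer_measure_of N (boundary dY 2 B)"
    obtain v where v: "0 < v" "\<And>x. ennreal v \<le> emeasure N (dball dY x 1)"
      using Y.volume_bounds(1)[of 1] by auto
    have "(\<Union>e\<in>B. dball dY e 1) \<subseteq> dball dY y (max 1 (r + 1))"
    proof clarify
      fix e x assume "e \<in> B" "dY e x \<le> 1"
      then show "dY y x \<le> max 1 (r + 1)" using bdd Y.triangle[of y x e] by force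
    qed
    then have "outer_measure_of N (\<Union>e\<in>B. dball dY e 1) \<le> emeasure N (dball dY y (max 1 (r + 1)))"
      by (metis Y.ball_measurable outer_measure_of_eq outer_measure_of_mono)
    also have "\<dots> < \<infinity>" by (rule Y.bounded_finite_measure) simp
    finally have fin: "outer_measure_of N (\<Union>e\<in>B. dball dY e 1) < \<infinity>" .
    obtain F where F: "finite F" "F \<subseteq> B" "B \<subseteq> (\<Union>z\<in>F. dball dY z 2)"
      by (rule Y.separated_net[OF fin v]) (rule that)
    define B' where "B' = (\<Union>z\<in>F. dball dY z 2)"
    have B': "B' \<in> sets N" "thick dY B'" "emeasure N B' < \<infinity>"
    proof -
      show "B' \<in> sets N" "thick dY B'"
        unfolding B'_def using F(1) by (auto intro!: Y.thick_UN Y.ball_thick)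
      have "emeasure N B' \<le> (\<Sum>z\<in>F. emeasure N (dball dY z 2))"
        unfolding B'_def using F(1) by (intro emeasure_subadditive_finite) auto
      also have "\<dots> < \<infinity>"
        using Y.bounded_finite_measure[of 2] by (subst infinity_ennreal_def, subst ennreal_sum_less_top) (auto simp: F(1))
      finally show "emeasure N B' < \<infinity>" .
    qed
    have "B \<subseteq> B'" using F(3) by (simp add: B'_def)
    have near: "\<exists>b\<in>B. dY x b \<le> 2" if "x \<in> B'" for x
      using that F(2) Y.sym unfolding B'_def by fastforce
    have diff: "B' - B \<subseteq> boundary dY 2 B"
    proof
      fix x assume "x \<in> B' - B"
      moreover have "dY x x \<le> 2" by simp
      ultimately show "x \<in> boundary dY 2 B" unfolding Y.mem_boundary using near by blast
    qed
    obtain W1 where W1: "W1 \<in> sets N" "boundary dY 2 B \<subseteq> W1" "emeasure N W1 \<le> ennreal c1 * ?e"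
      using c1(2)[of B] by auto
    obtain W2 where W2: "W2 \<in> sets N" "boundary dY 2 B \<subseteq> W2" "emeasure M (f -` W2) \<le> ennreal c2 * ?e"
      using c2(2)[of B] by auto
    have "close_upto (emeasure N B) (emeasure N B') (ennreal c1 * ?e)"
      using diff \<open>B \<subseteq> B'\<close> W1 B B' by (intro close_upto_mono[OF close_upto_emeasure W1(3)]) auto
    then have s1: "close_upto (ennreal \<kappa> * emeasure N B) (ennreal \<kappa> * emeasure N B') (ennreal (\<kappa> * c1) * ?e)"
      using \<open>\<kappa> > 0\<close> c1(1) close_upto_mult by (fastforce simp: ennreal_mult mult.assoc)
    have vim: "f -` A \<in> sets M" if "A \<in> sets N" for A
      using measurable_sets[OF meas that] by simp
    have s3: "close_upto (emeasure M (f -` B')) (emeasure M (f -` B)) (ennreal c2 * ?e)"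
    proof (rule close_upto_mono[OF close_upto_emeasure W2(3)])
      show "f -` B' - f -` B \<subseteq> f -` W2" "f -` B - f -` B' \<subseteq> f -` W2"
        using diff \<open>B \<subseteq> B'\<close> W2(2) by blast+
    qed (use vim B B' W2 in auto)
    have "boundary dY 2 B' \<subseteq> boundary dY 4 B"
    proof
      fix x assume "x \<in> boundary dY 2 B'"
      then obtain a b where a: "a \<in> B'" "dY x a \<le> 2" and b: "b \<notin> B'" "dY x b \<le> 2"
        unfolding Y.mem_boundary by blast
      obtain a' where "a' \<in> B" "dY a a' \<le> 2" using near[OF a(1)] by blast
      moreover from this a have "dY x a' \<le> 4" using Y.triangle[of x a' a] by linarith
      moreover have "b \<notin> B" using b \<open>B \<subseteq> B'\<close> by blast
      moreover have "dY x b \<le> 4" using b(2) by linarith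
      ultimately show "x \<in> boundary dY 4 B" unfolding Y.mem_boundary by blast
    qed
    then have "outer_measure_of N (boundary dY 2 B') \<le> ennreal c4 * ?e"
      using c4(2)[of B] outer_measure_of_mono order_trans by blast
    then have "ennreal C * outer_measure_of N (boundary dY 2 B') \<le> ennreal (C * c4) * ?e"
      using C(1) c4(1) by (simp add: ennreal_mult mult.assoc mult_left_mono)
    then have s2: "close_upto (ennreal \<kappa> * emeasure N B') (emeasure M (f -` B')) (ennreal (C * c4) * ?e)"
      using C(2)[OF B'(2,1,3)] unfolding quasi_measure_on_def by (metis close_upto_mono)
    show ?thesis
      unfolding quasi_measure_on_def
      using \<open>\<kappa> > 0\<close> c1(1) c2(1) C(1) c4(1)
      by (intro close_upto_trans_const[OF close_upto_trans_const[OF s1 s2] s3]) auto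
  qed
  moreover have "\<kappa> * c1 + C * c4 + c2 > 0" using \<open>\<kappa> > 0\<close> c1(1) c2(1) C(1) c4(1) by (simp add: add_pos_pos)
  ultimately show ?thesis by blast
qed

lemma quasi_isometry_compose:
  assumes "quasi_isometry dX dY f" "quasi_isometry dY dZ g" "Metric_space UNIV dZ"
  shows "quasi_isometry dX dZ (\<lambda>x. g (f x))"
proof -
  obtain C K where f: "C \<ge> 1" "K \<ge> 0" "\<And>x y. (1 / C) * dX x y - K \<le> dY (f x) (f y)"
    "\<And>x y. dY (f x) (f y) \<le> C * dX x y + K" "\<And>y. \<exists>x. dY y (f x) \<le> K"
    using assms(1) unfolding quasi_isometry_def by blast
  obtain D L where g: "D \<ge> 1" "L \<ge> 0" "\<And>x y. (1 / D) * dY x y - L \<le> dZ (g x) (g y)"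
    "\<And>x y. dZ (g x) (g y) \<le> D * dY x y + L" "\<And>y. \<exists>x. dZ y (g x) \<le> L"
    using assms(2) unfolding quasi_isometry_def by blast
  have tri: "dZ x z \<le> dZ x y + dZ y z" for x y z using assms(3) by (auto simp: Metric_space_def)
  define K' where "K' = D * K + 2 * L"
  have "K \<le> D * K" using f(2) g(1) by (simp add: mult_left_le mult_le_cancel_right1)
  have "1 \<le> C * D" using f(1) g(1) mult_mono[of 1 C 1 D] by simp
  moreover have "0 \<le> K'" using f(2) g(1,2) by (simp add: K'_def)
  moreover have "1 / (C * D) * dX x y - K' \<le> dZ (g (f x)) (g (f y)) \<and>
      dZ (g (f x)) (g (f y)) \<le> C * D * dX x y + K'" for x y
  proof
    have "dZ (g (f x)) (g (f y)) \<le> D * (C * dX x y + K) + L"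
      using g(4)[of "f x" "f y"] mult_left_mono[OF f(4)[of x y], of D] g(1) by linarith
    then show "dZ (g (f x)) (g (f y)) \<le> C * D * dX x y + K'"
      using g(2) by (simp add: K'_def algebra_simps)
    have "(1 / D) * ((1 / C) * dX x y - K) \<le> (1 / D) * dY (f x) (f y)"
      using f(3) g(1) by (intro mult_left_mono) auto
    moreover have "(1 / D) * K \<le> D * K"
    proof -
      have "(1 / D) * K \<le> 1 * K" using g(1) f(2) by (intro mult_right_mono) auto
      then show ?thesis using \<open>K \<le> D * K\<close> by simp
    qed
    ultimately show "1 / (C * D) * dX x y - K' \<le> dZ (g (f x)) (g (f y))"
      using g(2) g(3)[of "f x" "f y"] by (simp add: K'_def algebra_simps)
  qed
  moreover have "\<exists>x. dZ z (g (f x)) \<le> K'" for z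
  proof -
    obtain y where y: "dZ z (g y) \<le> L" using g(5) by blast
    obtain x where x: "dY y (f x) \<le> K" using f(5) by blast
    have "dZ (g y) (g (f x)) \<le> D * K + L"
      using g(4)[of y "f x"] mult_left_mono[OF x, of D] g(1) by linarith
    then have "dZ z (g (f x)) \<le> K'" using tri[of z "g (f x)" "g y"] y by (simp add: K'_def)
    then show ?thesis by blast
  qed
  ultimately show ?thesis unfolding quasi_isometry_def by blast
qed

lemma quasi_isometry_vimage_bounded:
  assumes "integral_mms dX M" "integral_mms dY N" "quasi_isometry dX dY f" "A \<subseteq> dball dY y r"
  shows "\<exists>x s. f -` A \<subseteq> dball dX x s"
  using quasi_isometry_preimage_ball[OF assms(1-3), of r] assms(4) by (meson order_trans vimage_mono)

text \<open>
  For thick \<open>A\<close> of finite measure, compare \<open>A\<close> with \<open>g\<^sup>-\<^sup>1 A\<close> and then the bounded set \<open>g\<^sup>-\<^sup>1 A\<close> with its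
  preimage under \<open>f\<close>. The error of the second step is a multiple of the boundary of \<open>g\<^sup>-\<^sup>1 A\<close>, hence
  of the boundary of \<open>A\<close>.
\<close>

theorem has_scaling_factor_compose:
  assumes X: "integral_mms dX L" and Y: "integral_mms dY M" and Z: "integral_mms dZ N"
    and f: "has_scaling_factor dX L dY M f \<kappa>" and g: "has_scaling_factor dY M dZ N g \<tau>"
  shows "has_scaling_factor dX L dZ N (\<lambda>x. g (f x)) (\<kappa> * \<tau>)"
proof -
  interpret X: integral_mms dX L by fact
  interpret Y: integral_mms dY M by fact
  interpret Z: integral_mms dZ N by fact
  have f': "quasi_isometry dX dY f" "\<kappa> > 0" "f \<in> measurable L M"
    using f by (auto simp: has_scaling_factor_def quasi_to_one_iff)
  obtain D where g': "quasi_isometry dY dZ g" "\<tau> > 0" "g \<in> measurable M N" and D: "D > 0"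
    "\<And>A. thick dZ A \<Longrightarrow> A \<in> sets N \<Longrightarrow> emeasure N A < \<infinity> \<Longrightarrow> quasi_measure_on g M dZ N \<tau> D A"
    using g unfolding has_scaling_factor_def quasi_to_one_iff by blast
  obtain C where C: "C > 0"
    "\<And>B y r. B \<in> sets M \<Longrightarrow> B \<subseteq> dball dY y r \<Longrightarrow> quasi_measure_on f L dY M \<kappa> C B"
    using quasi_measure_on_bounded[OF X Y f] by blast
  obtain c where c: "c > 0" "\<And>A. outer_measure_of M (boundary dY 2 (g -` A))
      \<le> ennreal c * outer_measure_of N (boundary dZ 2 A)"
    using boundary_vimage_outer_measure_le[OF Y Z g'(1,3)] by blast
  have "quasi_measure_on (\<lambda>x. g (f x)) L dZ N (\<kappa> * \<tau>) (\<kappa> * D + C * c) A"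
    if A: "thick dZ A" "A \<in> sets N" "emeasure N A < \<infinity>" for A
  proof -
    let ?e = "outer_measure_of N (boundary dZ 2 A)"
    obtain z r where "A \<subseteq> dball dZ z r" using Z.thick_finite_imp_bounded[OF A] .
    then obtain y s where bdd: "g -` A \<subseteq> dball dY y s"
      using quasi_isometry_vimage_bounded[OF Y Z g'(1)] by blast
    have "g -` A \<in> sets M" using measurable_sets[OF g'(3) A(2)] by simp
    from C(2)[OF this bdd] have "close_upto (ennreal \<kappa> * emeasure M (g -` A)) (emeasure L (f -` g -` A))
        (ennreal C * outer_measure_of M (boundary dY 2 (g -` A)))"
      by (simp add: quasi_measure_on_def)
    moreover have "ennreal C * outer_measure_of M (boundary dY 2 (g -` A)) \<le> ennreal (C * c) * ?e"
      using c C(1) by (simp add: ennreal_mult mult.assoc mult_left_mono)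
    ultimately have s2: "close_upto (ennreal \<kappa> * emeasure M (g -` A)) (emeasure L (f -` g -` A))
        (ennreal (C * c) * ?e)" by (rule close_upto_mono)
    have "close_upto (ennreal \<kappa> * (ennreal \<tau> * emeasure N A)) (ennreal \<kappa> * emeasure M (g -` A))
        (ennreal \<kappa> * (ennreal D * ?e))"
      using D(2)[OF A] unfolding quasi_measure_on_def by (rule close_upto_mult)
    then have s1: "close_upto (ennreal (\<kappa> * \<tau>) * emeasure N A) (ennreal \<kappa> * emeasure M (g -` A))
        (ennreal (\<kappa> * D) * ?e)"
      using f'(2) g'(2) D(1) by (simp add: ennreal_mult mult.assoc)
    from close_upto_trans_const[OF s1 s2] show ?thesis
      using f'(2) D(1) C(1) c(1) by (simp add: quasi_measure_on_def vimage_def)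
  qed
  moreover have "\<kappa> * D + C * c > 0" using f'(2) D(1) C(1) c(1) by (simp add: add_pos_pos)
  ultimately show ?thesis
    using X.standard Z.standard quasi_isometry_compose[OF f'(1) g'(1) Z.metric]
      measurable_compose[OF f'(3) g'(3)] mult_pos_pos[OF f'(2) g'(2)]
    by (intro has_scaling_factorI)
qed

lemma quasi_isometry_quasi_inverse:
  assumes X: "integral_mms dX M" and Y: "integral_mms dY N" and f: "quasi_isometry dX dY f"
    and K: "\<And>y. dY (f (g y)) y \<le> K"
  shows "quasi_isometry dY dX g" and "\<exists>L. \<forall>x. dX (g (f x)) x \<le> L"
proof -
  interpret X: integral_mms dX M by fact
  interpret Y: integral_mms dY N by fact
  obtain C K0 where f': "C \<ge> 1" "K0 \<ge> 0" "\<And>x y. (1 / C) * dX x y - K0 \<le> dY (f x) (f y)"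
    "\<And>x y. dY (f x) (f y) \<le> C * dX x y + K0"
    using f unfolding quasi_isometry_def by blast
  have "K \<ge> 0" using K Y.nonneg order_trans by blast
  have lower: "dX x y \<le> C * dY (f x) (f y) + C * K0" for x y
    using f'(3)[of x y] f'(1) by (simp add: field_simps)
  define L where "L = C * (2 * K + K0)"
  have near: "dX (g (f x)) x \<le> L" for x
  proof -
    have "C * dY (f (g (f x))) (f x) \<le> C * K" using K f'(1) by (intro mult_left_mono) auto
    moreover have "C * K \<le> C * (2 * K)" using \<open>K \<ge> 0\<close> f'(1) by (intro mult_left_mono) auto
    ultimately show ?thesis using lower[of "g (f x)" x] by (simp add: L_def algebra_simps)
  qed
  then show "\<exists>L. \<forall>x. dX (g (f x)) x \<le> L" by blast
  have move: "dY (f (g y)) (f (g y')) \<le> dY y y' + 2 * K" "dY y y' \<le> dY (f (g y)) (f (g y')) + 2 * K" for y y'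
    using Y.triangle[of "f (g y)" "f (g y')" y] Y.triangle[of y "f (g y')" y'] K[of y] K[of y'] Y.sym
      Y.triangle[of y y' "f (g y)"] Y.triangle[of "f (g y)" y' "f (g y')"] by smt+
  have "L \<ge> 0" using f'(1,2) \<open>K \<ge> 0\<close> by (simp add: L_def)
  have LK: "2 * K + K0 \<le> L" using mult_right_mono[OF f'(1), of "2*K+K0"] f'(2) \<open>K \<ge> 0\<close> by (simp add: L_def)
  have "1 / C * dY y y' - L \<le> dX (g y) (g y') \<and> dX (g y) (g y') \<le> C * dY y y' + L" for y y'
  proof
    have "dX (g y) (g y') \<le> C * (dY y y' + 2 * K) + C * K0"
      using lower[of "g y" "g y'"] mult_left_mono[OF move(1)[of y y'], of C] f'(1) by linarith
    then show "dX (g y) (g y') \<le> C * dY y y' + L" by (simp add: L_def algebra_simps)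
    have "dY y y' \<le> C * dX (g y) (g y') + (K0 + 2 * K)"
      using move(2)[of y y'] f'(4)[of "g y" "g y'"] by linarith
    then have "(1 / C) * dY y y' \<le> (1 / C) * (C * dX (g y) (g y') + (K0 + 2 * K))"
      using f'(1) by (intro mult_left_mono) auto
    also have "\<dots> = dX (g y) (g y') + (1 / C) * (K0 + 2 * K)" using f'(1) by (simp add: field_simps)
    finally have "(1 / C) * dY y y' \<le> dX (g y) (g y') + (1 / C) * (K0 + 2 * K)" .
    moreover have "(1 / C) * (K0 + 2 * K) \<le> 1 * (K0 + 2 * K)"
      using f'(1,2) \<open>K \<ge> 0\<close> by (intro mult_right_mono) auto
    ultimately have "(1 / C) * dY y y' \<le> dX (g y) (g y') + 1 * (K0 + 2 * K)"
      by (meson add_left_mono order_trans)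
    then show "1 / C * dY y y' - L \<le> dX (g y) (g y')" using LK by simp
  qed
  moreover have "\<exists>y. dX x (g y) \<le> L" for x using near[of x] X.sym[of x] by metis
  ultimately show "quasi_isometry dY dX g"
    unfolding quasi_isometry_def using f'(1) \<open>L \<ge> 0\<close> by blast
qed

text \<open>
  The map \<open>g \<circ> f\<close> moves points by a bounded amount, so that \<open>A\<close> and \<open>f\<^sup>-\<^sup>1 (g\<^sup>-\<^sup>1 A)\<close> differ only inside a boundary of
  \<open>A\<close>. The latter set is compared with \<open>g\<^sup>-\<^sup>1 A\<close> through the scaling factor of \<open>f\<close>.
\<close>

theorem has_scaling_factor_quasi_inverse:
  assumes X: "integral_mms dX M" and Y: "integral_mms dY N" and f: "has_scaling_factor dX M dY N f \<kappa>"
    and g: "g \<in> measurable N M" and K: "\<And>y. dY (f (g y)) y \<le> K"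
  shows "has_scaling_factor dY N dX M g (1 / \<kappa>)"
proof -
  interpret X: integral_mms dX M by fact
  interpret Y: integral_mms dY N by fact
  have f': "quasi_isometry dX dY f" "\<kappa> > 0" "f \<in> measurable M N"
    using f by (auto simp: has_scaling_factor_def quasi_to_one_iff)
  have gi: "quasi_isometry dY dX g" by (rule quasi_isometry_quasi_inverse(1)[OF X Y f'(1) K])
  obtain L where L: "\<And>x. dX (g (f x)) x \<le> L"
    using quasi_isometry_quasi_inverse(2)[OF X Y f'(1) K] by blast
  obtain C where C: "C > 0"
    "\<And>B y r. B \<in> sets N \<Longrightarrow> B \<subseteq> dball dY y r \<Longrightarrow> quasi_measure_on f M dY N \<kappa> C B"
    using quasi_measure_on_bounded[OF X Y f] by blast
  obtain c where c: "c > 0" "\<And>A. outer_measure_of N (boundary dY 2 (g -` A))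
      \<le> ennreal c * outer_measure_of M (boundary dX 2 A)"
    using boundary_vimage_outer_measure_le[OF Y X gi g] by blast
  obtain c1 where c1: "c1 > 0" "\<And>A. \<exists>W\<in>sets M. boundary dX L A \<subseteq> W \<and>
    emeasure M ((\<lambda>x. x) -` W) \<le> ennreal c1 * outer_measure_of M (boundary dX 2 A)"
    using boundary_cover[OF X X quasi_isometry_id[OF X]] by metis
  have "quasi_measure_on g N dX M (1 / \<kappa>) (1 / \<kappa> * (c1 + C * c)) A"
    if A: "thick dX A" "A \<in> sets M" "emeasure M A < \<infinity>" for A
  proof -
    let ?e = "outer_measure_of M (boundary dX 2 A)"
    obtain x r where "A \<subseteq> dball dX x r" using X.thick_finite_imp_bounded[OF A] .
    then obtain y s where bdd: "g -` A \<subseteq> dball dY y s"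
      using quasi_isometry_vimage_bounded[OF Y X gi] by blast
    have gA: "g -` A \<in> sets N" using measurable_sets[OF g A(2)] by simp
    have fgA: "f -` g -` A \<in> sets M" using measurable_sets[OF f'(3) gA] by simp
    obtain W where W: "W \<in> sets M" "boundary dX L A \<subseteq> W" "emeasure M W \<le> ennreal c1 * ?e"
      using c1(2)[of A] by auto
    have "L \<ge> 0" using L X.nonneg order_trans by blast
    have "x \<in> boundary dX L A" if "(x \<in> A) \<noteq> (g (f x) \<in> A)" for x
      using that L[of x] X.sym[of x "g (f x)"] X.zero[of x] \<open>L \<ge> 0\<close> unfolding X.mem_boundary by metis
    then have s1: "close_upto (emeasure M A) (emeasure M (f -` g -` A)) (ennreal c1 * ?e)"
      using W fgA A(2) by (intro close_upto_mono[OF close_upto_emeasure W(3)]) auto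
    from C(2)[OF gA bdd] have "close_upto (ennreal \<kappa> * emeasure N (g -` A)) (emeasure M (f -` g -` A))
        (ennreal C * outer_measure_of N (boundary dY 2 (g -` A)))"
      by (simp add: quasi_measure_on_def)
    moreover have "ennreal C * outer_measure_of N (boundary dY 2 (g -` A)) \<le> ennreal (C * c) * ?e"
      using c C(1) by (simp add: ennreal_mult mult.assoc mult_left_mono)
    ultimately have s2: "close_upto (emeasure M (f -` g -` A)) (ennreal \<kappa> * emeasure N (g -` A))
        (ennreal (C * c) * ?e)" by (metis close_upto_mono close_upto_sym)
    have "close_upto (ennreal (1 / \<kappa>) * emeasure M A) (ennreal (1 / \<kappa>) * (ennreal \<kappa> * emeasure N (g -` A)))
        (ennreal (1 / \<kappa>) * (ennreal (c1 + C * c) * ?e))"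
      using c1(1) C(1) c(1) by (intro close_upto_mult close_upto_trans_const[OF s1 s2]) auto
    moreover have "ennreal (1 / \<kappa>) * (ennreal \<kappa> * emeasure N (g -` A)) = emeasure N (g -` A)"
      using f'(2) by (simp add: mult.assoc[symmetric] ennreal_mult[symmetric])
    moreover have "ennreal (1 / \<kappa>) * (ennreal (c1 + C * c) * ?e) = ennreal (1 / \<kappa> * (c1 + C * c)) * ?e"
      using f'(2) c1(1) C(1) c(1) by (subst ennreal_mult) (auto simp: mult.assoc)
    ultimately show ?thesis by (simp add: quasi_measure_on_def)
  qed
  moreover have "1 / \<kappa> * (c1 + C * c) > 0" using f'(2) c1(1) C(1) c(1) by (simp add: add_pos_pos)
  moreover have "1 / \<kappa> > 0" using f'(2) by simp
  ultimately show ?thesis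
    using gi g X.standard Y.standard by (intro has_scaling_factorI)
qed

section \<open>Word metrics of compactly generated groups\<close>

lemma sum_list_rev_uminus: "sum_list (rev (map uminus w)) = - sum_list (w :: 'g::group_add list)"
  by (induction w) (auto simp: minus_add)

locale compactly_generated =
  fixes S :: "'g::{topological_group_add, t2_space} set"
  assumes generating: "compact_generating_set S"
begin

abbreviation len :: "'g \<Rightarrow> nat" where "len \<equiv> word_length S"

lemma word_witness:
  obtains w where "w \<in> lists S" "length w = len g" "sum_list w = g"
proof -
  have "\<exists>n. \<exists>w\<in>lists S. length w = n \<and> sum_list w = g"
    using generating unfolding compact_generating_set_def by metis
  from LeastI_ex[OF this] show thesis using that unfolding word_length_def by blast
qed

lemma len_le: "w \<in> lists S \<Longrightarrow> len (sum_list w) \<le> length w"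
  unfolding word_length_def by (rule Least_le) auto

lemma len_0 [simp]: "len 0 = 0"
  using len_le[of "[]"] by simp

lemma len_eq_0_iff: "len g = 0 \<longleftrightarrow> g = 0"
proof
  assume "len g = 0"
  then show "g = 0" using word_witness[of g] by (metis length_0_conv sum_list.Nil)
qed simp

lemma len_add: "len (g + h) \<le> len g + len h"
proof -
  obtain u w where "u \<in> lists S" "length u = len g" "sum_list u = g"
    "w \<in> lists S" "length w = len h" "sum_list w = h" using word_witness by metis
  then show ?thesis using len_le[of "u @ w"] by simp
qed

lemma len_minus [simp]: "len (- g) = len g"
proof -
  have "len (- g) \<le> len g" for g
  proof -
    obtain w where w: "w \<in> lists S" "length w = len g" "sum_list w = g" using word_witness .
    have "rev (map uminus w) \<in> lists S"
      using w(1) generating by (force simp: compact_generating_set_def lists_eq_set)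
    from len_le[OF this] show ?thesis using w by (simp add: sum_list_rev_uminus)
  qed
  from this[of g] this[of "- g"] show ?thesis by simp
qed

lemma len_generator: "s \<in> S \<Longrightarrow> len s \<le> 1"
  using len_le[of "[s]"] by simp

lemma compact_len_ball: "compact {g. len g \<le> n}"
proof -
  define P where "P n = {sum_list w |w. w \<in> lists S \<and> length w = n}" for n
  have "compact (P n)" for n
  proof (induction n)
    case 0
    have "P 0 = {0}" by (auto simp: P_def)
    then show ?case by simp
  next
    case (Suc n)
    have "P (Suc n) = (\<lambda>p. fst p + snd p) ` (S \<times> P n)"
    proof (intro equalityI subsetI)
      fix x assume "x \<in> P (Suc n)"
      then obtain w where "w \<in> lists S" "length w = Suc n" "x = sum_list w" by (auto simp: P_def)
      then obtain s w' where "w = s # w'" "s \<in> S" "w' \<in> lists S" "length w' = n"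
        by (cases w) (simp_all add: that)
      then show "x \<in> (\<lambda>p. fst p + snd p) ` (S \<times> P n)"
        using \<open>x = sum_list w\<close> unfolding P_def by (intro image_eqI[of _ _ "(s, sum_list w')"]) auto
    next
      fix x assume "x \<in> (\<lambda>p. fst p + snd p) ` (S \<times> P n)"
      then obtain s w where "s \<in> S" "w \<in> lists S" "length w = n" "x = s + sum_list w"
        by (force simp: P_def)
      then show "x \<in> P (Suc n)" unfolding P_def by (auto intro!: exI[of _ "s # w"])
    qed
    moreover have "compact ((\<lambda>p. fst p + snd p) ` (S \<times> P n))"
      using generating Suc unfolding compact_generating_set_def
      by (intro compact_continuous_image compact_Times continuous_intros) auto
    ultimately show ?case by simp
  qed
  moreover have "{g. len g \<le> n} = (\<Union>m\<in>{..n}. P m)"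
  proof (intro equalityI subsetI)
    fix g assume "g \<in> {g. len g \<le> n}"
    moreover obtain w where "w \<in> lists S" "length w = len g" "sum_list w = g" using word_witness .
    ultimately show "g \<in> (\<Union>m\<in>{..n}. P m)"
      unfolding P_def by (intro UN_I[of "len g"]) auto
  qed (auto simp: P_def intro: order_trans[OF len_le])
  ultimately show ?thesis by (simp add: compact_UN)
qed

lemma compact_len_ball_real: "compact {g. real (len g) \<le> r}"
proof (cases "r \<ge> 0")
  case True
  then have "{g. real (len g) \<le> r} = {g. len g \<le> nat \<lfloor>r\<rfloor>}" by (auto simp: le_nat_floor) linarith
  then show ?thesis by (simp add: compact_len_ball)
next
  case False
  then have "{g. real (len g) \<le> r} = {}" by (auto simp: not_le intro: less_le_trans)
  then show ?thesis by simp
qed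

text \<open>
  Translate an interior point \<open>s\<close> of \<open>S\<close> to the origin; the elements of \<open>- s + S\<close> are products of two generators.
\<close>

lemma open_nbhd_of_0:
  obtains U where "open U" "0 \<in> U" "\<And>u. u \<in> U \<Longrightarrow> len u \<le> 2"
proof -
  obtain s where s: "s \<in> interior S" using generating by (auto simp: compact_generating_set_def)
  define U where "U = (\<lambda>x. s + x) -` interior S"
  have "open U" unfolding U_def by (intro open_vimage continuous_intros) auto
  moreover have "len u \<le> 2" if "u \<in> U" for u
  proof -
    have "s + u \<in> S" "s \<in> S" using that s interior_subset by (auto simp: U_def)
    then show ?thesis using len_add[of "- s" "s + u"] len_generator[of s] len_generator[of "s + u"]
      by (simp add: add.assoc[symmetric])
  qed
  ultimately show thesis using that[of U] s by (auto simp: U_def)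
qed

lemma compact_finite_net:
  assumes "compact K"
  obtains F where "F \<subseteq> K" "finite F" "K \<subseteq> (\<Union>h\<in>F. {x. len (- h + x) \<le> 2})"
proof -
  obtain U where U: "open U" "0 \<in> U" "\<And>u. u \<in> U \<Longrightarrow> len u \<le> 2" using open_nbhd_of_0 by metis
  have "open ((\<lambda>x. - h + x) -` U)" for h
    using U(1) by (intro open_vimage continuous_intros)
  moreover have "K \<subseteq> (\<Union>h\<in>K. (\<lambda>x. - h + x) -` U)" using U(2) by force
  ultimately obtain F where F: "F \<subseteq> K" "finite F" "K \<subseteq> (\<Union>h\<in>F. (\<lambda>x. - h + x) -` U)"
    by (rule compactE_image[OF assms])
  have "(\<Union>h\<in>F. (\<lambda>x. - h + x) -` U) \<subseteq> (\<Union>h\<in>F. {x. len (- h + x) \<le> 2})" using U(3) by auto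
  with F(3) have "K \<subseteq> (\<Union>h\<in>F. {x. len (- h + x) \<le> 2})" by (rule order_trans)
  with F(1,2) show thesis by (rule that)
qed

lemma compact_imp_len_bounded:
  assumes "compact K"
  obtains n where "K \<subseteq> {g. len g \<le> n}"
proof -
  obtain F where F: "F \<subseteq> K" "finite F" "K \<subseteq> (\<Union>h\<in>F. {x. len (- h + x) \<le> 2})"
    using compact_finite_net[OF assms] .
  have "len g \<le> Max (insert 0 (len ` F)) + 2" if g: "g \<in> K" for g
  proof -
    obtain h where "h \<in> F" "len (- h + g) \<le> 2" using F(3) g by auto
    moreover from this have "len h \<le> Max (insert 0 (len ` F))" using F(2) by auto
    ultimately show ?thesis using len_add[of h "- h + g"] by simp
  qed
  then have "K \<subseteq> {g. len g \<le> Max (insert 0 (len ` F)) + 2}" by (intro subsetI CollectI)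
  then show thesis by (rule that)
qed

lemma compact_subset_open_bounded:
  assumes "compact K"
  obtains W n where "open W" "K \<subseteq> W" "W \<subseteq> {g. len g \<le> n}"
proof -
  obtain U where U: "open U" "0 \<in> U" "\<And>u. u \<in> U \<Longrightarrow> len u \<le> 2" using open_nbhd_of_0 by metis
  obtain n where n: "K \<subseteq> {g. len g \<le> n}" using compact_imp_len_bounded[OF assms] .
  define W where "W = (\<Union>h\<in>K. (\<lambda>x. - h + x) -` U)"
  have "open W" unfolding W_def
    using U(1) by (intro open_UN ballI open_vimage continuous_intros)
  moreover have "K \<subseteq> W" using U(2) by (force simp: W_def)
  moreover have "W \<subseteq> {g. len g \<le> n + 2}"
  proof
    fix g assume "g \<in> W"
    then obtain h where "h \<in> K" "- h + g \<in> U" by (auto simp: W_def)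
    then show "g \<in> {g. len g \<le> n + 2}"
      using len_add[of h "- h + g"] U(3) n by (fastforce simp: add.assoc[symmetric])
  qed
  ultimately show thesis using that by blast
qed

lemma Metric_space_word_metric: "Metric_space UNIV (word_metric S)"
proof
  fix x y z :: 'g
  have "- (- x + y) = - y + x" by (simp add: minus_add)
  then show "word_metric S x y = word_metric S y x"
    unfolding word_metric_def by (metis len_minus)
  have "- x + y = 0 \<longleftrightarrow> x = y" by (metis add.inverse_inverse eq_neg_iff_add_eq_0 neg_eq_iff_add_eq_0)
  then show "word_metric S x y = 0 \<longleftrightarrow> x = y" by (simp add: word_metric_def len_eq_0_iff)
  have "- x + z = (- x + y) + (- y + z)" by (simp add: add.assoc)
  then show "word_metric S x z \<le> word_metric S x y + word_metric S y z"
    unfolding word_metric_def by (metis len_add of_nat_add of_nat_le_iff)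
qed (simp add: word_metric_def)

lemma dball_word_metric: "dball (word_metric S) x r = (\<lambda>y. x + y) ` {g. real (len g) \<le> r}"
proof (intro equalityI subsetI)
  fix y assume "y \<in> dball (word_metric S) x r"
  then show "y \<in> (\<lambda>y. x + y) ` {g. real (len g) \<le> r}"
    by (intro image_eqI[of _ _ "- x + y"]) (auto simp: word_metric_def add.assoc[symmetric])
qed (auto simp: word_metric_def add.assoc[symmetric])

lemma word_metric_translate [simp]: "word_metric S x (x + g) = real (len g)"
  by (simp add: word_metric_def add.assoc[symmetric])

end

section \<open>Haar measure and word metrics\<close>

locale haar_group = compactly_generated S for S :: "'g::{topological_group_add, t2_space} set" +
  fixes M :: "'g measure"
  assumes locally_compact: "locally_compact_space (euclidean :: 'g topology)"
    and haar: "left_haar_measure M"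
begin

lemma sets_eq [measurable_cong]: "sets M = sets borel" and space_eq [simp]: "space M = UNIV"
  using haar sets_eq_imp_space_eq[of M borel] by (auto simp: left_haar_measure_def)

lemma compact_finite: "compact K \<Longrightarrow> emeasure M K < \<infinity>"
  using haar by (auto simp: left_haar_measure_def)

lemma translate_invariant: "A \<in> sets borel \<Longrightarrow> emeasure M ((\<lambda>x. g + x) ` A) = emeasure M A"
  using haar by (auto simp: left_haar_measure_def)

lemma measurable_translate [measurable]: "(\<lambda>x. g + x) \<in> M \<rightarrow>\<^sub>M M"
  unfolding measurable_cong_sets[OF sets_eq sets_eq]
  by (intro borel_measurable_continuous_onI continuous_intros)

lemma distr_translate: "distr M M (\<lambda>x. g + x) = M"
proof (rule measure_eqI)
  fix A assume "A \<in> sets (distr M M (\<lambda>x. g + x))"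
  then have A: "A \<in> sets M" by simp
  have "(\<lambda>x. g + x) -` A = (\<lambda>x. - g + x) ` A"
  proof (intro equalityI subsetI)
    fix x assume "x \<in> (\<lambda>x. g + x) -` A"
    then show "x \<in> (\<lambda>x. - g + x) ` A"
      by (intro image_eqI[of _ _ "g + x"]) (auto simp: add.assoc[symmetric])
  qed (auto simp: add.assoc[symmetric])
  then show "emeasure (distr M M (\<lambda>x. g + x)) A = emeasure M A"
    using A translate_invariant[of A "- g"] by (simp add: emeasure_distr sets_eq)
qed simp

lemma nn_integral_translate:
  "u \<in> borel_measurable M \<Longrightarrow> (\<integral>\<^sup>+x. u (g + x) \<partial>M) = (\<integral>\<^sup>+x. u x \<partial>M)"
  using nn_integral_distr[of "\<lambda>x. g + x" M M u] by (simp add: distr_translate)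

text \<open>
  Finitely many translates of \<open>U\<close> cover a given compact set. If \<open>U\<close> were null, all compact sets would
  be null, and by inner regularity the measure would vanish.
\<close>

lemma open_positive:
  assumes "open U" "U \<noteq> {}" shows "emeasure M U > 0"
proof (rule ccontr)
  assume "\<not> emeasure M U > 0"
  then have 0: "emeasure M U = 0" by simp
  obtain u where u: "u \<in> U" using assms(2) by blast
  have null: "emeasure M K = 0" if K: "compact K" for K
  proof -
    have "open ((\<lambda>x. u + (- h + x)) -` U)" for h
      using assms(1) by (intro open_vimage continuous_intros)
    moreover have "K \<subseteq> (\<Union>h\<in>K. (\<lambda>x. u + (- h + x)) -` U)" using u by force
    ultimately obtain H where H: "finite H" "K \<subseteq> (\<Union>h\<in>H. (\<lambda>x. u + (- h + x)) -` U)"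
      using compactE_image[OF K, of K "\<lambda>h. (\<lambda>x. u + (- h + x)) -` U"] by metis
    have "(\<lambda>x. u + (- h + x)) -` U = (\<lambda>x. (h + - u) + x) ` U" for h
    proof (intro equalityI subsetI)
      fix x assume "x \<in> (\<lambda>x. u + (- h + x)) -` U"
      then show "x \<in> (\<lambda>x. (h + - u) + x) ` U"
        by (intro image_eqI[of _ _ "u + (- h + x)"])
          (auto simp: add.assoc simp del: add_uminus_conv_diff)
    qed (auto simp: add.assoc minus_add simp del: add_uminus_conv_diff)
    then have "emeasure M ((\<lambda>x. u + (- h + x)) -` U) = 0" for h
      using translate_invariant[of U "h + - u"] 0 assms(1) by simp
    moreover have "(\<lambda>x. u + (- h + x)) -` U \<in> sets M" for h
      using \<open>\<And>h. open ((\<lambda>x. u + (- h + x)) -` U)\<close> by (simp add: sets_eq)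
    ultimately have "(\<lambda>x. u + (- h + x)) -` U \<in> null_sets M" for h
      by (auto intro: null_setsI)
    then have "(\<Union>h\<in>H. (\<lambda>x. u + (- h + x)) -` U) \<in> null_sets M"
      using H(1) by (intro null_sets.finite_UN) auto
    then show "emeasure M K = 0"
      using H(2) by (metis emeasure_mono le_zero_eq null_setsD1 null_setsD2)
  qed
  have "emeasure M UNIV = (SUP K\<in>{K. compact K \<and> K \<subseteq> UNIV}. emeasure M K)"
    using haar unfolding left_haar_measure_def by blast
  also have "\<dots> = 0" using null by (auto intro!: SUP_eqI)
  finally show False using haar by (simp add: left_haar_measure_def)
qed

lemma sigma_finite: "sigma_finite_measure M"
proof
  show "\<exists>A. countable A \<and> A \<subseteq> sets M \<and> \<Union> A = space M \<and> (\<forall>a\<in>A. emeasure M a \<noteq> \<infinity>)"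
  proof (intro exI[of _ "range (\<lambda>n. {g. len g \<le> n})"] conjI)
    show "range (\<lambda>n. {g. len g \<le> n}) \<subseteq> sets M"
      using compact_len_ball by (auto simp: sets_eq intro!: borel_compact)
    show "\<forall>a\<in>range (\<lambda>n. {g. len g \<le> n}). emeasure M a \<noteq> \<infinity>"
      using compact_finite[OF compact_len_ball] by (auto simp: less_top)
  qed auto
qed

text \<open>
  Word balls are compact, which gives measurability of the metric and, with left invariance, volumes independent
  of the centre. The partial sums of a shortest word form the required path.
\<close>

lemma integral_mms_word_metric: "integral_mms (word_metric S) M"
proof
  let ?d = "word_metric S"
  note ball = mcball_eq_dball[OF Metric_space_word_metric]
  show "?d x y \<in> \<nat>" for x y by (simp add: word_metric_def)
  have "(\<lambda>(x, y). ?d x y) \<in> borel_measurable (borel :: ('g \<times> 'g) measure)"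
  proof (rule borel_measurableI_le)
    fix a
    have "{p \<in> space borel. (case p of (x, y) \<Rightarrow> ?d x y) \<le> a}
        = (\<lambda>p. - fst p + snd p) -` {g. real (len g) \<le> a}"
      by (auto simp: word_metric_def)
    moreover have "closed ((\<lambda>p::'g \<times> 'g. - fst p + snd p) -` {g. real (len g) \<le> a})"
      using compact_len_ball_real by (intro closed_vimage compact_imp_closed continuous_intros) auto
    ultimately show "{p \<in> space borel. (case p of (x, y) \<Rightarrow> ?d x y) \<le> a} \<in> sets (borel :: ('g \<times> 'g) measure)"
      by simp
  qed
  moreover have "\<exists>U. open U \<and> x \<in> U \<and> emeasure M U < \<infinity>" for x
  proof -
    obtain U K where "open U" "compact K" "x \<in> U" "U \<subseteq> K"
      using locally_compact unfolding locally_compact_space_def by (simp, metis)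
    moreover from this have "emeasure M U < \<infinity>"
      using compact_finite[of K] emeasure_mono[of U K M] borel_compact[of K]
      by (auto simp: sets_eq intro: le_less_trans)
    ultimately show ?thesis by blast
  qed
  moreover have cb: "compact (dball ?d x r)" for x r
    unfolding dball_word_metric using compact_len_ball_real
    by (intro compact_continuous_image continuous_intros)
  ultimately have mms: "metric_measure_space ?d M"
    unfolding metric_measure_space_def ball
    using locally_compact sets_eq haar Metric_space_word_metric
    by (auto simp: left_haar_measure_def compact_imp_closed)
  have vol: "\<exists>v V. 0 < v \<and> v \<le> V \<and> (\<forall>x. ennreal v \<le> emeasure M (dball ?d x r) \<and>
      emeasure M (dball ?d x r) \<le> ennreal V)" if "r \<ge> 1" for r :: real
  proof -
    let ?m = "emeasure M {g. real (len g) \<le> r}"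
    have "emeasure M (dball ?d x r) = ?m" for x
      unfolding dball_word_metric using compact_len_ball_real by (intro translate_invariant borel_compact)
    moreover have "?m < \<infinity>" by (intro compact_finite compact_len_ball_real)
    moreover have "0 < ?m"
    proof -
      have "0 < emeasure M (interior S)"
        using generating by (intro open_positive) (auto simp: compact_generating_set_def)
      also have "\<dots> \<le> ?m"
      proof (intro emeasure_mono)
        show "interior S \<subseteq> {g. real (len g) \<le> r}"
          using len_generator interior_subset[of S] that by force
        show "{g. real (len g) \<le> r} \<in> sets M" using compact_len_ball_real by (simp add: sets_eq borel_compact)
      qed
      finally show ?thesis .
    qed
    ultimately show ?thesis
      by (intro exI[of _ "enn2real ?m"]) (auto simp: enn2real_positive_iff less_top)
  qed
  have path: "\<exists>(n::nat) z. z 0 = x \<and> z n = y \<and> (\<forall>i\<in>{1..n}. ?d (z (i - 1)) (z i) \<le> 1) \<and>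
        ?d x y = (\<Sum>i=1..n. ?d (z (i - 1)) (z i))" for x y
  proof -
    obtain w where w: "w \<in> lists S" "length w = len (- x + y)" "sum_list w = - x + y"
      using word_witness .
    define z where "z i = x + sum_list (take i w)" for i
    have step: "?d (z (i - 1)) (z i) \<le> 1" if "i \<in> {1..length w}" for i
    proof -
      have "i - 1 < length w" using that by auto
      then have "z i = z (i - 1) + w ! (i - 1)"
        using take_Suc_conv_app_nth[of "i - 1" w] that by (simp add: z_def add.assoc)
      moreover have "w ! (i - 1) \<in> S" using w(1) \<open>i - 1 < length w\<close> by (auto simp: lists_eq_set)
      ultimately show ?thesis using len_generator by simp
    qed
    have ends: "z 0 = x" "z (length w) = y"
      using w(3) by (auto simp: z_def add.assoc[symmetric])
    have "?d (z 0) (z k) \<le> (\<Sum>i=1..k. ?d (z (i - 1)) (z i))" for k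
    proof (induction k)
      case 0 then show ?case by (simp add: word_metric_def)
    next
      case (Suc k)
      then show ?case
        using Metric_space.triangle[OF Metric_space_word_metric, of "z 0" "z k" "z (Suc k)"] by simp
    qed
    from this[of "length w"] have "?d x y \<le> (\<Sum>i=1..length w. ?d (z (i - 1)) (z i))"
      by (simp add: ends)
    moreover have "(\<Sum>i=1..length w. ?d (z (i - 1)) (z i)) \<le> (\<Sum>i=1..length w. 1)"
      using step by (intro sum_mono) auto
    moreover have "(\<Sum>i=1..length w. 1) = ?d x y" using w(2) by (simp add: word_metric_def)
    ultimately show ?thesis using step ends by (intro exI[of _ "length w"] exI[of _ z]) auto
  qed
  show "standard_mms ?d M"
    unfolding standard_mms_def ball using mms vol path by blast
qed

end

section \<open>Continuous functions on products of \<open>\<sigma>\<close>-compact spaces\<close>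

text \<open>
  The set where \<open>q\<close> is greater than \<open>a\<close> is a countable union of compact sets
  \<open>(C i \<times> D j) \<inter> {q \<ge> a + 1 / (n + 1)}\<close>, and each of them is covered by finitely many open rectangles inside it.
\<close>

lemma pair_measurable_continuous:
  fixes q :: "'a::topological_space \<times> 'b::topological_space \<Rightarrow> real"
  assumes q: "continuous_on UNIV q"
    and C: "\<And>n::nat. compact (C n :: 'a set)" "(\<Union>n. C n) = UNIV"
    and D: "\<And>n::nat. compact (D n :: 'b set)" "(\<Union>n. D n) = UNIV"
  shows "q \<in> borel_measurable (borel \<Otimes>\<^sub>M borel)"
proof (rule borel_measurableI_greater)
  fix a :: real
  let ?O = "{p. a < q p}"
  have "open ?O" using q by (intro open_Collect_less continuous_intros)
  have cover: "\<exists>R\<in>sets (borel \<Otimes>\<^sub>M borel). (C i \<times> D j) \<inter> {p. a + inverse (real (Suc n)) \<le> q p} \<subseteq> R \<and> R \<subseteq> ?O" for i j n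
  proof -
    let ?K = "(C i \<times> D j) \<inter> {p. a + inverse (real (Suc n)) \<le> q p}"
    have "closed {p. a + inverse (real (Suc n)) \<le> q p}" using q by (intro closed_Collect_le continuous_intros)
    then have K: "compact ?K" by (intro compact_Int_closed compact_Times C D)
    have sub: "?K \<subseteq> ?O"
    proof clarify
      fix x y assume "a + inverse (real (Suc n)) \<le> q (x, y)"
      moreover have "0 < inverse (real (Suc n))" by simp
      ultimately show "a < q (x, y)" by linarith
    qed
    have "\<exists>U V. open U \<and> open V \<and> p \<in> U \<times> V \<and> U \<times> V \<subseteq> ?O" if "p \<in> ?K" for p
      using open_prod_elim[OF \<open>open ?O\<close>, of p] sub that by (metis subset_iff)
    then obtain U V where UV: "\<And>p. p \<in> ?K \<Longrightarrow> open (U p) \<and> open (V p) \<and> p \<in> U p \<times> V p \<and> U p \<times> V p \<subseteq> ?O"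
      by metis
    have "open (U p \<times> V p)" if "p \<in> ?K" for p using UV[OF that] by (simp add: open_Times)
    moreover have "?K \<subseteq> (\<Union>p\<in>?K. U p \<times> V p)"
    proof
      fix p assume "p \<in> ?K" with UV[OF this] show "p \<in> (\<Union>p\<in>?K. U p \<times> V p)" by blast
    qed
    ultimately obtain P where P: "P \<subseteq> ?K" "finite P" "?K \<subseteq> (\<Union>p\<in>P. U p \<times> V p)"
      by (rule compactE_image[OF K])
    have "U p \<times> V p \<in> sets (borel \<Otimes>\<^sub>M borel)" if "p \<in> P" for p
      using that P(1) UV by (blast intro: pair_measureI borel_open)
    then have "(\<Union>p\<in>P. U p \<times> V p) \<in> sets (borel \<Otimes>\<^sub>M borel)" using P(2) by blast
    moreover have "(\<Union>p\<in>P. U p \<times> V p) \<subseteq> ?O" using P(1) UV by blast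
    ultimately show ?thesis using P(3) by blast
  qed
  then obtain R where R: "\<And>i j n. R i j n \<in> sets (borel \<Otimes>\<^sub>M borel)"
    "\<And>i j n. (C i \<times> D j) \<inter> {p. a + inverse (real (Suc n)) \<le> q p} \<subseteq> R i j n" "\<And>i j n. R i j n \<subseteq> ?O"
    by metis
  have "?O = (\<Union>i j n. R i j n)"
  proof (intro equalityI subsetI)
    fix p assume p: "p \<in> ?O"
    then obtain n where n: "inverse (real (Suc n)) < q p - a" using reals_Archimedean[of "q p - a"] by auto
    obtain i j where "fst p \<in> C i" "snd p \<in> D j" using C(2) D(2) by blast
    moreover have "a + inverse (real (Suc n)) \<le> q p" using n by linarith
    ultimately have "p \<in> (C i \<times> D j) \<inter> {p. a + inverse (real (Suc n)) \<le> q p}"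
      by (simp add: mem_Times_iff)
    from subsetD[OF R(2) this] show "p \<in> (\<Union>i j n. R i j n)" by (intro UN_I UNIV_I)
  next
    fix p assume "p \<in> (\<Union>i j n. R i j n)"
    then obtain i j n where "p \<in> R i j n" by (elim UN_E)
    with R(3) show "p \<in> ?O" by (rule subsetD)
  qed
  moreover have "(\<Union>i j n. R i j n) \<in> sets (borel \<Otimes>\<^sub>M borel)"
    using R(1) by (intro sets.countable_UN) auto
  ultimately show "{p \<in> space (borel \<Otimes>\<^sub>M borel). a < q p} \<in> sets (borel \<Otimes>\<^sub>M borel)"
    by (simp add: space_pair_measure)
qed

section \<open>Proper cocompact morphisms\<close>

locale proper_cocompact_morphism =
  G: haar_group SG \<mu>G + H: haar_group SH \<mu>H
  for SG :: "'g::{topological_group_add, t2_space} set" and \<mu>G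
    and SH :: "'h::{topological_group_add, t2_space} set" and \<mu>H +
  fixes \<phi> :: "'g \<Rightarrow> 'h"
  assumes morphism: "group_morphism \<phi>" and continuous: "continuous_on UNIV \<phi>"
    and proper: "proper_morphism \<phi>" and cocompact: "cocompact_morphism \<phi>"
begin

lemma map_add: "\<phi> (x + y) = \<phi> x + \<phi> y"
  using morphism by (simp add: group_morphism_def)

lemma map_0 [simp]: "\<phi> 0 = 0"
  using map_add[of 0 0] by (metis add.right_neutral add_left_imp_eq)

lemma map_minus: "\<phi> (- x) = - \<phi> x"
  using map_add[of "- x" x] by (simp add: eq_neg_iff_add_eq_0)

lemma map_sum_list: "\<phi> (sum_list w) = sum_list (map \<phi> w)"
  by (induction w) (auto simp: map_add)

lemma compact_vimage: "compact K \<Longrightarrow> compact (\<phi> -` K)"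
  using proper by (simp add: proper_morphism_def)

text \<open>
  The upper bound holds because \<open>\<phi>\<close> maps generators into a word ball. For the lower bound, a word for \<open>\<phi> g\<close>
  is followed in \<open>H\<close> and each of its prefixes is approximated by a point of \<open>\<phi>(G)\<close> up to \<open>K\<close>. The increments
  between consecutive approximations lie in the compact set \<open>Q = K + SH - K\<close>, and properness bounds the word
  length of their lifts to \<open>G\<close>.
\<close>

lemma map_quasi_isometry: "quasi_isometry (word_metric SG) (word_metric SH) \<phi>"
proof -
  obtain K0 where K0: "compact K0" "\<And>h. \<exists>g. \<exists>k\<in>K0. h = \<phi> g + k"
    using cocompact unfolding cocompact_morphism_def by blast
  \<comment> \<open>Adjoining the identity lets the empty word be lifted to the identity.\<close>
  define K where "K = insert 0 K0"
  have K: "compact K" "0 \<in> K" "\<And>h. \<exists>g. \<exists>k\<in>K. h = \<phi> g + k"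
    using K0(1) unfolding K_def by (simp_all add: compact_insert) (use K0(2) in blast)
  have "compact SG" "compact SH" using G.generating H.generating by (auto simp: compact_generating_set_def)
  have "compact (\<phi> ` SG)"
    using \<open>compact SG\<close> by (intro compact_continuous_image continuous_on_subset[OF continuous]) auto
  then obtain a where a: "\<phi> ` SG \<subseteq> {g. H.len g \<le> a}" using H.compact_imp_len_bounded by metis
  have upper: "H.len (\<phi> g) \<le> a * G.len g" for g
  proof -
    obtain w where w: "w \<in> lists SG" "length w = G.len g" "sum_list w = g" using G.word_witness .
    have "H.len (sum_list (map \<phi> w)) \<le> a * length w" if "w \<in> lists SG" for w
      using that
    proof (induction w)
      case (Cons s w)
      then show ?case using H.len_add[of "\<phi> s" "sum_list (map \<phi> w)"] a by fastforce
    qed simp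
    then show ?thesis using w by (metis map_sum_list)
  qed
  define Q where "Q = (\<lambda>(k, s, k'). k + s + - k') ` (K \<times> SH \<times> K)"
  have "compact Q"
    unfolding Q_def case_prod_beta using K \<open>compact SH\<close>
    by (intro compact_continuous_image compact_Times continuous_intros)
  then obtain b where b: "\<phi> -` Q \<subseteq> {g. G.len g \<le> b}"
    using G.compact_imp_len_bounded compact_vimage by metis
  obtain b' where b': "\<phi> -` K \<subseteq> {g. G.len g \<le> b'}"
    using G.compact_imp_len_bounded compact_vimage K(1) by metis
  \<comment> \<open>Follow a word of \<open>H\<close> letter by letter, staying within \<open>K\<close> of the image of \<open>\<phi>\<close>.\<close>
  have lift: "\<exists>g. \<exists>k\<in>K. sum_list w = \<phi> g + k \<and> G.len g \<le> b * length w" if "w \<in> lists SH" for w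
    using that
  proof (induction w rule: rev_induct)
    case Nil
    then show ?case using K(2) by (intro exI[of _ 0] bexI[of _ 0]) auto
  next
    case (snoc s w)
    then obtain g k where gk: "k \<in> K" "sum_list w = \<phi> g + k" "G.len g \<le> b * length w" by auto
    obtain g' k' where gk': "k' \<in> K" "\<phi> g + k + s = \<phi> g' + k'" using K(3) by blast
    have "\<phi> (- g + g') = - \<phi> g + (\<phi> g' + k') + - k'"
      by (simp add: map_add map_minus add.assoc del: add_uminus_conv_diff)
    also have "\<dots> = k + s + - k'"
      unfolding gk'(2)[symmetric] by (simp add: add.assoc[symmetric] del: add_uminus_conv_diff)
    also have "\<dots> \<in> Q" unfolding Q_def using gk(1) gk'(1) snoc.prems by force
    finally have "G.len (- g + g') \<le> b" using b by auto
    then have "G.len g' \<le> b * length (w @ [s])"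
      using G.len_add[of g "- g + g'"] gk(3) by (simp add: add.assoc[symmetric])
    then show ?case using gk gk' by (intro exI[of _ g'] bexI[of _ k']) auto
  qed
  have lower: "G.len g \<le> b * H.len (\<phi> g) + b'" for g
  proof -
    obtain w where w: "w \<in> lists SH" "length w = H.len (\<phi> g)" "sum_list w = \<phi> g" using H.word_witness .
    obtain g' k where g': "k \<in> K" "\<phi> g = \<phi> g' + k" "G.len g' \<le> b * H.len (\<phi> g)"
      using lift[OF w(1)] w by auto
    have "\<phi> (- g' + g) = k" using g'(2) by (simp add: map_add map_minus add.assoc[symmetric])
    then have "G.len (- g' + g) \<le> b'" using b' g'(1) by auto
    then show ?thesis using G.len_add[of g' "- g' + g"] g'(3) by (simp add: add.assoc[symmetric])
  qed
  obtain e where e: "K \<subseteq> {g. H.len g \<le> e}" using H.compact_imp_len_bounded[OF K(1)] .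
  define C where "C = real (1 + a + b)"
  define L where "L = real (b' + e)"
  have map_diff: "- \<phi> x + \<phi> y = \<phi> (- x + y)" for x y by (simp add: map_add map_minus)
  have "1 / C * word_metric SG x y - L \<le> word_metric SH (\<phi> x) (\<phi> y) \<and>
      word_metric SH (\<phi> x) (\<phi> y) \<le> C * word_metric SG x y + L" for x y :: 'g
  proof
    let ?g = "- x + y"
    have "real (H.len (\<phi> ?g)) \<le> real a * real (G.len ?g)"
      using upper[of ?g] by (metis of_nat_le_iff of_nat_mult)
    also have "\<dots> \<le> C * real (G.len ?g)" by (intro mult_right_mono) (auto simp: C_def)
    finally show "word_metric SH (\<phi> x) (\<phi> y) \<le> C * word_metric SG x y + L"
      by (simp add: word_metric_def map_diff L_def)
    have "real (G.len ?g) \<le> real b * real (H.len (\<phi> ?g)) + real b'"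
      using lower[of ?g] by (metis of_nat_add of_nat_le_iff of_nat_mult)
    also have "\<dots> \<le> C * real (H.len (\<phi> ?g)) + C * L"
      by (intro add_mono mult_right_mono) (auto simp: C_def L_def intro: order_trans[OF _ mult_right_mono[of 1]])
    finally have "real (G.len ?g) \<le> C * (real (H.len (\<phi> ?g)) + L)" by (simp add: algebra_simps)
    then have "real (G.len ?g) / C \<le> real (H.len (\<phi> ?g)) + L"
      by (simp add: C_def divide_le_eq mult.commute)
    then show "1 / C * word_metric SG x y - L \<le> word_metric SH (\<phi> x) (\<phi> y)"
      by (simp add: word_metric_def map_diff)
  qed
  moreover have "\<exists>x. word_metric SH y (\<phi> x) \<le> L" for y
  proof -
    obtain g k where "k \<in> K" "y = \<phi> g + k" using K(3) by blast
    moreover have "- (\<phi> g + k) + \<phi> g = - k" by (simp add: minus_add add.assoc)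
    ultimately have "word_metric SH y (\<phi> g) \<le> L" using e by (auto simp: word_metric_def L_def)
    then show ?thesis by blast
  qed
  moreover have "1 \<le> C" "0 \<le> L" by (simp_all add: C_def L_def)
  ultimately show ?thesis unfolding quasi_isometry_def by blast
qed

lemma map_measurable: "\<phi> \<in> \<mu>G \<rightarrow>\<^sub>M \<mu>H"
  unfolding measurable_cong_sets[OF G.sets_eq H.sets_eq]
  using continuous by (rule borel_measurable_continuous_onI)

text \<open>
  Start from a continuous \<open>f0\<close> with compact support that equals 1 on \<open>V\<^sup>-\<^sup>1 K\<close>, where \<open>V\<close> is a
  neighbourhood of the identity, and divide it by its orbit integrals \<open>F h = \<integral> f0(\<phi>(g)\<^sup>-\<^sup>1 h) dg\<close>. These are
  invariant under \<open>\<phi>(G)\<close>, so the division normalizes every orbit at once. By cocompactness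
  it is enough to bound \<open>F\<close> from below on \<open>K\<close>: there the integrand is 1 whenever \<open>\<phi> g \<in> V\<close>. Properness
  makes \<open>F\<close> finite.
\<close>

lemma bruhat_function:
  obtains f :: "'h \<Rightarrow> ennreal" and n :: nat and c :: real where
    "(\<lambda>(g, h). f (- \<phi> g + h)) \<in> borel_measurable (\<mu>G \<Otimes>\<^sub>M \<mu>H)" "f \<in> borel_measurable \<mu>H"
    "\<And>h. (\<integral>\<^sup>+g. f (- \<phi> g + h) \<partial>\<mu>G) = 1"
    "\<And>h. f h \<noteq> 0 \<Longrightarrow> H.len h \<le> n"
    "c > 0" "(\<integral>\<^sup>+h. f h \<partial>\<mu>H) = ennreal c"
proof -
  obtain K where K: "compact K" "\<And>h. \<exists>g. \<exists>k\<in>K. h = \<phi> g + k"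
    using cocompact unfolding cocompact_morphism_def by blast
  define V where "V = {h. H.len h \<le> 2}"
  have V: "compact V" unfolding V_def by (rule H.compact_len_ball)
  define D where "D = (\<lambda>p. - fst p + snd p) ` (V \<times> K)"
  have D: "compact D"
    unfolding D_def using V K(1) by (intro compact_continuous_image compact_Times continuous_intros)
  obtain W n where W: "open W" "D \<subseteq> W" "W \<subseteq> {h. H.len h \<le> n}"
    using H.compact_subset_open_bounded[OF D] .
  have "Hausdorff_space (euclidean :: 'h topology)"
    unfolding Hausdorff_space_def disjnt_def by (auto, metis hausdorff)
  then have "completely_regular_space (euclidean :: 'h topology)"
    using H.locally_compact by (intro locally_compact_regular_imp_completely_regular_space) auto
  moreover have "disjnt D (- W)" using W(2) by (auto simp: disjnt_def)
  ultimately obtain f0 :: "'h \<Rightarrow> real" where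
    "continuous_map euclidean (top_of_set {0..1}) f0" "f0 ` (- W) \<subseteq> {0}" "f0 ` D \<subseteq> {1}"
    using Urysohn_completely_regular_compact_closed[of 0 1 "euclidean :: 'h topology" D "- W"] D W(1)
    by auto
  then have cont: "continuous_on UNIV f0" and range: "0 \<le> f0 h" "f0 h \<le> 1"
    and out: "h \<notin> W \<Longrightarrow> f0 h = 0" and one: "h \<in> D \<Longrightarrow> f0 h = 1" for h
    by (auto simp: continuous_map_in_subtopology image_subset_iff Pi_iff)
  have GC: "\<And>n. compact {g. G.len g \<le> n}" "(\<Union>n. {g. G.len g \<le> n}) = UNIV"
    and HC: "\<And>n. compact {g. H.len g \<le> n}" "(\<Union>n. {g. H.len g \<le> n}) = UNIV"
    using G.compact_len_ball H.compact_len_ball by auto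
  have cont\<phi>: "continuous_on UNIV (\<lambda>x. \<phi> (u x))" if "continuous_on UNIV u" for u :: "'x::topological_space \<Rightarrow> 'g"
    using continuous_on_compose2[OF continuous that] by simp
  have contf: "continuous_on UNIV (\<lambda>x. f0 (u x))" if "continuous_on UNIV u" for u :: "'x::topological_space \<Rightarrow> 'h"
    using continuous_on_compose2[OF cont that] by simp
  have "(\<lambda>p. f0 (- \<phi> (fst p) + snd p)) \<in> borel_measurable (borel \<Otimes>\<^sub>M borel)"
    by (rule pair_measurable_continuous[OF _ GC HC]) (intro contf cont\<phi> continuous_intros)
  moreover have "sets (\<mu>G \<Otimes>\<^sub>M \<mu>H) = sets (borel \<Otimes>\<^sub>M borel)"
    by (intro sets_pair_measure_cong G.sets_eq H.sets_eq)
  ultimately have q1 [measurable]: "(\<lambda>p. f0 (- \<phi> (fst p) + snd p)) \<in> borel_measurable (\<mu>G \<Otimes>\<^sub>M \<mu>H)"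
    by (simp cong: measurable_cong_sets)
  have "(\<lambda>p. f0 (- \<phi> (snd p) + fst p)) \<in> borel_measurable (borel \<Otimes>\<^sub>M borel)"
    by (rule pair_measurable_continuous[OF _ HC GC]) (intro contf cont\<phi> continuous_intros)
  moreover have "sets (\<mu>H \<Otimes>\<^sub>M \<mu>G) = sets (borel \<Otimes>\<^sub>M borel)"
    by (intro sets_pair_measure_cong G.sets_eq H.sets_eq)
  ultimately have q2: "(\<lambda>p. f0 (- \<phi> (snd p) + fst p)) \<in> borel_measurable (\<mu>H \<Otimes>\<^sub>M \<mu>G)"
    by (simp cong: measurable_cong_sets)
  have f0_meas [measurable]: "f0 \<in> borel_measurable \<mu>H"
    unfolding measurable_cong_sets[OF H.sets_eq refl] using cont by (rule borel_measurable_continuous_onI)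
  have sect [measurable]: "(\<lambda>g. f0 (- \<phi> g + h)) \<in> borel_measurable \<mu>G" for h
    unfolding measurable_cong_sets[OF G.sets_eq refl]
    by (intro borel_measurable_continuous_onI contf cont\<phi> continuous_intros)
  interpret sG: sigma_finite_measure \<mu>G by (rule G.sigma_finite)
  define F where "F h = (\<integral>\<^sup>+g. ennreal (f0 (- \<phi> g + h)) \<partial>\<mu>G)" for h
  have F_meas [measurable]: "F \<in> borel_measurable \<mu>H"
    unfolding F_def using q2 by (intro sG.borel_measurable_nn_integral) (simp add: case_prod_beta)
  have F_inv: "F (\<phi> g' + h) = F h" for g' h
  proof -
    have "(\<integral>\<^sup>+g. ennreal (f0 (- \<phi> (- g' + g) + h)) \<partial>\<mu>G) = F h"
      unfolding F_def by (rule G.nn_integral_translate) measurable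
    moreover have "- \<phi> (- g' + g) + h = - \<phi> g + (\<phi> g' + h)" for g
      by (simp add: map_add map_minus minus_add add.assoc)
    ultimately show ?thesis by (simp add: F_def)
  qed
  define m where "m = emeasure \<mu>G (\<phi> -` V)"
  have "m > 0"
  proof -
    obtain U where U: "open U" "0 \<in> U" "U \<subseteq> V"
      using H.open_nbhd_of_0 unfolding V_def by (metis mem_Collect_eq subsetI)
    have "open (\<phi> -` U)" using U(1) continuous by (rule open_vimage)
    then have "0 < emeasure \<mu>G (\<phi> -` U)" using U(2) map_0 by (intro G.open_positive) (auto simp del: map_0)
    also have "\<dots> \<le> m"
      unfolding m_def using U(3) compact_vimage[OF V] by (intro emeasure_mono) (auto simp: G.sets_eq borel_compact)
    finally show ?thesis .
  qed
  have F_lower: "m \<le> F h" for h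
  proof -
    obtain g k where gk: "k \<in> K" "h = \<phi> g + k" using K(2) by blast
    have "m = (\<integral>\<^sup>+g. indicator (\<phi> -` V) g \<partial>\<mu>G)"
      unfolding m_def using compact_vimage[OF V] by (subst nn_integral_indicator) (auto simp: G.sets_eq borel_compact)
    also have "\<dots> \<le> F k"
      unfolding F_def
    proof (intro nn_integral_mono)
      fix g
      have "f0 (- \<phi> g + k) = 1" if "\<phi> g \<in> V"
        using that gk(1) by (intro one) (force simp: D_def)
      then show "indicator (\<phi> -` V) g \<le> ennreal (f0 (- \<phi> g + k))"
        by (auto simp: indicator_def)
    qed
    finally show ?thesis unfolding gk(2) F_inv .
  qed
  have F_finite: "F h < \<infinity>" for h
  proof -
    let ?B = "(\<lambda>b. h + - b) ` {b. H.len b \<le> n}"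
    have B: "compact ?B" by (intro compact_continuous_image continuous_intros H.compact_len_ball)
    have "F h \<le> (\<integral>\<^sup>+g. indicator (\<phi> -` ?B) g \<partial>\<mu>G)"
      unfolding F_def
    proof (intro nn_integral_mono)
      fix g
      have "\<phi> g \<in> ?B" if "f0 (- \<phi> g + h) \<noteq> 0"
      proof -
        have "H.len (- \<phi> g + h) \<le> n" using that out W(3) by blast
        moreover have "\<phi> g = h + - (- \<phi> g + h)" by (simp add: minus_add add.assoc[symmetric] del: add_uminus_conv_diff)
        ultimately show ?thesis by blast
      qed
      then show "ennreal (f0 (- \<phi> g + h)) \<le> indicator (\<phi> -` ?B) g"
        using range(2)[of "- \<phi> g + h"] by (cases "f0 (- \<phi> g + h) = 0") simp_all
    qed
    also have "\<dots> = emeasure \<mu>G (\<phi> -` ?B)"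
      using compact_vimage[OF B] by (subst nn_integral_indicator) (auto simp: G.sets_eq borel_compact)
    also have "\<dots> < \<infinity>" by (intro G.compact_finite compact_vimage B)
    finally show ?thesis .
  qed
  define f where "f h = ennreal (f0 h) / F h" for h
  have f_shift: "f (- \<phi> g + h) = ennreal (f0 (- \<phi> g + h)) / F h" for g h
    using F_inv[of "- g" h] by (simp add: f_def map_minus)
  show thesis
  proof (rule that[of f n "enn2real (\<integral>\<^sup>+h. f h \<partial>\<mu>H)"])
    show f_meas: "f \<in> borel_measurable \<mu>H" unfolding f_def by measurable
    show "(\<lambda>(g, h). f (- \<phi> g + h)) \<in> borel_measurable (\<mu>G \<Otimes>\<^sub>M \<mu>H)"
      unfolding f_shift case_prod_beta by measurable
    show "(\<integral>\<^sup>+g. f (- \<phi> g + h) \<partial>\<mu>G) = 1" for h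
    proof -
      have "(\<integral>\<^sup>+g. f (- \<phi> g + h) \<partial>\<mu>G) = F h / F h"
        unfolding f_shift by (subst nn_integral_divide) (auto simp: F_def)
      also have "\<dots> = 1" using F_finite[of h] F_lower[of h] \<open>m > 0\<close> by (intro ennreal_divide_self) auto
      finally show ?thesis .
    qed
    show "H.len h \<le> n" if "f h \<noteq> 0" for h
      using that out[of h] W(3) by (cases "h \<in> W") (auto simp: f_def)
    let ?B = "{h. H.len h \<le> n}"
    have B: "?B \<in> sets \<mu>H" using H.compact_len_ball by (simp add: H.sets_eq borel_compact)
    have "(\<integral>\<^sup>+h. f h \<partial>\<mu>H) \<le> (\<integral>\<^sup>+h. inverse m * indicator ?B h \<partial>\<mu>H)"
    proof (intro nn_integral_mono)
      fix h
      show "f h \<le> inverse m * indicator ?B h"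
      proof (cases "h \<in> W")
        case True
        obtain r where r: "F h = ennreal r" "r \<ge> 0" using F_finite[of h] by (cases "F h") auto
        have "m < \<infinity>" using F_lower[of h] F_finite[of h] by (rule le_less_trans)
        then obtain s where s: "m = ennreal s" "s > 0" using \<open>m > 0\<close> by (cases m) auto
        have "s \<le> r" using F_lower[of h] r(2) by (simp add: r(1) s(1))
        then have "f0 h / r \<le> 1 / s" using range(2)[of h] s(2) by (intro frac_le) auto
        then have "f h \<le> inverse m"
          using range(1)[of h] r s \<open>s \<le> r\<close>
          by (simp add: f_def divide_ennreal inverse_ennreal inverse_eq_divide)
        then show ?thesis using True W(3) by auto
      qed (auto simp: f_def out)
    qed
    also have "\<dots> = inverse m * emeasure \<mu>H ?B" using B by (rule nn_integral_cmult_indicator)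
    also have "\<dots> < \<infinity>"
      using \<open>m > 0\<close> H.compact_finite[OF H.compact_len_ball, of n]
      by (auto simp: ennreal_mult_eq_top_iff less_top[symmetric])
    finally have fin: "(\<integral>\<^sup>+h. f h \<partial>\<mu>H) < \<infinity>" .
    have "(\<integral>\<^sup>+h. f h \<partial>\<mu>H) \<noteq> 0"
    proof
      assume "(\<integral>\<^sup>+h. f h \<partial>\<mu>H) = 0"
      then have "emeasure \<mu>H {h \<in> space \<mu>H. f h \<noteq> 0} = 0"
        using f_meas by (simp add: nn_integral_0_iff)
      moreover have "{h \<in> space \<mu>H. f h \<noteq> 0} = {h. 0 < f0 h}"
        using range(1) F_finite by (auto simp: f_def ennreal_divide_eq_0_iff less_top[symmetric] order_less_le)
      moreover have "open {h. 0 < f0 h}" using cont by (intro open_Collect_less continuous_intros)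
      moreover have "{h. 0 < f0 h} \<noteq> {}"
      proof -
        obtain k where "k \<in> K" using K(2) by blast
        then have "- 0 + k \<in> D" unfolding D_def V_def by (intro image_eqI[of _ _ "(0, k)"]) auto
        then have "f0 k = 1" by (intro one) simp
        then have "k \<in> {h. 0 < f0 h}" by simp
        then show ?thesis by blast
      qed
      ultimately show False using H.open_positive[of "{h. 0 < f0 h}"] by simp
    qed
    then show "0 < enn2real (\<integral>\<^sup>+h. f h \<partial>\<mu>H)"
      using fin by (simp add: enn2real_positive_iff less_top zero_less_iff_neq_zero)
    show "(\<integral>\<^sup>+h. f h \<partial>\<mu>H) = ennreal (enn2real (\<integral>\<^sup>+h. f h \<partial>\<mu>H))"
      using fin by simp
  qed
qed

text \<open>
  The function \<open>I\<close> below is \<open>g \<mapsto> \<integral> 1\<^sub>A(h) f(\<phi>(g)\<^sup>-\<^sup>1 h) dh = \<integral> 1\<^sub>A(\<phi>(g) h) f(h) dh\<close>. The first form is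
  the one with a jointly measurable integrand and gives \<open>\<integral> I = \<mu>H(A)\<close>. The second form shows that \<open>I\<close> equals
  \<open>c\<close> times the indicator function of \<open>\<phi>\<^sup>-\<^sup>1 A\<close> away from the preimage of a boundary of \<open>A\<close>.
\<close>

theorem map_scaling_factor: "\<exists>\<kappa>. has_scaling_factor (word_metric SG) \<mu>G (word_metric SH) \<mu>H \<phi> \<kappa>"
proof -
  interpret GI: integral_mms "word_metric SG" \<mu>G by (rule G.integral_mms_word_metric)
  interpret HI: integral_mms "word_metric SH" \<mu>H by (rule H.integral_mms_word_metric)
  interpret sG: sigma_finite_measure \<mu>G by (rule G.sigma_finite)
  interpret sH: sigma_finite_measure \<mu>H by (rule H.sigma_finite)
  interpret P: pair_sigma_finite \<mu>G \<mu>H ..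
  obtain f :: "'h \<Rightarrow> ennreal" and n :: nat and c :: real where
    f: "(\<lambda>(g, h). f (- \<phi> g + h)) \<in> borel_measurable (\<mu>G \<Otimes>\<^sub>M \<mu>H)" "f \<in> borel_measurable \<mu>H"
      "\<And>h. (\<integral>\<^sup>+g. f (- \<phi> g + h) \<partial>\<mu>G) = 1" and supp: "\<And>h. f h \<noteq> 0 \<Longrightarrow> H.len h \<le> n"
    and c: "c > 0" "(\<integral>\<^sup>+h. f h \<partial>\<mu>H) = ennreal c"
    using bruhat_function by metis
  note f(2)[measurable]
  have f1 [measurable]: "(\<lambda>p. f (- \<phi> (fst p) + snd p)) \<in> borel_measurable (\<mu>G \<Otimes>\<^sub>M \<mu>H)"
    using f(1) by (simp add: case_prod_beta)
  have sect [measurable]: "(\<lambda>g. f (- \<phi> g + h)) \<in> borel_measurable \<mu>G" for h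
    using measurable_compose[of "\<lambda>g. (g, h)" \<mu>G "\<mu>G \<Otimes>\<^sub>M \<mu>H", OF _ f1] by simp
  obtain a where a: "a > 0" "\<And>A. \<exists>W\<in>sets \<mu>H. boundary (word_metric SH) n A \<subseteq> W \<and>
    emeasure \<mu>G (\<phi> -` W) \<le> ennreal a * outer_measure_of \<mu>H (boundary (word_metric SH) 2 A)"
    using boundary_cover[OF GI.integral_mms_axioms HI.integral_mms_axioms map_quasi_isometry] by metis
  have "quasi_measure_on \<phi> \<mu>G (word_metric SH) \<mu>H (1 / c) a A" if A [measurable]: "A \<in> sets \<mu>H" for A
  proof -
    obtain W where W [measurable]: "W \<in> sets \<mu>H" and bd: "boundary (word_metric SH) n A \<subseteq> W"
      and Wle: "emeasure \<mu>G (\<phi> -` W) \<le> ennreal a * outer_measure_of \<mu>H (boundary (word_metric SH) 2 A)"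
      using a(2)[of A] by blast
    have vim [measurable]: "\<phi> -` B \<in> sets \<mu>G" if "B \<in> sets \<mu>H" for B
      using measurable_sets[OF map_measurable that] by simp
    have [measurable]: "\<phi> -` A \<in> sets \<mu>G" "\<phi> -` W \<in> sets \<mu>G" using A W by (auto intro: vim)
    define I where "I g = (\<integral>\<^sup>+h. f (- \<phi> g + h) * indicator A h \<partial>\<mu>H)" for g
    have I_meas [measurable]: "I \<in> borel_measurable \<mu>G"
      unfolding I_def by (intro sH.borel_measurable_nn_integral) (simp add: case_prod_beta)
    have I_eq: "I g = (\<integral>\<^sup>+h. f h * indicator A (\<phi> g + h) \<partial>\<mu>H)" for g
    proof -
      have "(\<integral>\<^sup>+h. f (- \<phi> g + (\<phi> g + h)) * indicator A (\<phi> g + h) \<partial>\<mu>H) = I g"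
        unfolding I_def by (rule H.nn_integral_translate) measurable
      then show ?thesis by (simp add: add.assoc[symmetric])
    qed
    have int_I: "(\<integral>\<^sup>+g. I g \<partial>\<mu>G) = emeasure \<mu>H A"
    proof -
      have "(\<integral>\<^sup>+g. I g \<partial>\<mu>G) = (\<integral>\<^sup>+h. (\<integral>\<^sup>+g. f (- \<phi> g + h) * indicator A h \<partial>\<mu>G) \<partial>\<mu>H)"
        unfolding I_def by (intro P.Fubini'[symmetric]) (simp add: case_prod_beta)
      also have "\<dots> = (\<integral>\<^sup>+h. indicator A h \<partial>\<mu>H)"
        by (simp add: nn_integral_multc f(3))
      also have "\<dots> = emeasure \<mu>H A" by simp
      finally show ?thesis .
    qed
    have pointwise: "close_upto (I g) (ennreal c * indicator (\<phi> -` A) g) (ennreal c * indicator (\<phi> -` W) g)" for g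
    proof (cases "\<phi> g \<in> W")
      case True
      have "I g \<le> (\<integral>\<^sup>+h. f h \<partial>\<mu>H)"
        unfolding I_eq by (intro nn_integral_mono) (auto simp: indicator_def)
      then show ?thesis using True c(2) unfolding close_upto_def
        by (auto simp: indicator_def intro: add_increasing)
    next
      case False
      have "indicator A (\<phi> g + h) = (indicator A (\<phi> g) :: ennreal)" if "f h \<noteq> 0" for h
      proof -
        have "word_metric SH (\<phi> g) (\<phi> g + h) \<le> n" using supp[OF that] by simp
        moreover have "\<phi> g \<notin> boundary (word_metric SH) n A" using False bd by blast
        moreover have "word_metric SH (\<phi> g) (\<phi> g) \<le> n" by simp
        ultimately have "\<phi> g + h \<in> A \<longleftrightarrow> \<phi> g \<in> A" unfolding HI.mem_boundary by blast
        then show ?thesis by (simp add: indicator_def)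
      qed
      then have "I g = (\<integral>\<^sup>+h. f h * indicator A (\<phi> g) \<partial>\<mu>H)"
        unfolding I_eq by (intro nn_integral_cong) (metis mult_zero_left)
      then have "I g = ennreal c * indicator (\<phi> -` A) g"
        by (simp add: nn_integral_multc c(2) indicator_def)
      then show ?thesis by (simp add: close_upto_def)
    qed
    have "close_upto (\<integral>\<^sup>+g. I g \<partial>\<mu>G) (\<integral>\<^sup>+g. ennreal c * indicator (\<phi> -` A) g \<partial>\<mu>G)
        (\<integral>\<^sup>+g. ennreal c * indicator (\<phi> -` W) g \<partial>\<mu>G)"
      unfolding close_upto_def
    proof
      show "(\<integral>\<^sup>+g. I g \<partial>\<mu>G) \<le> (\<integral>\<^sup>+g. ennreal c * indicator (\<phi> -` A) g \<partial>\<mu>G) + (\<integral>\<^sup>+g. ennreal c * indicator (\<phi> -` W) g \<partial>\<mu>G)"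
        using pointwise by (subst nn_integral_add[symmetric]) (auto intro!: nn_integral_mono simp: close_upto_def)
      show "(\<integral>\<^sup>+g. ennreal c * indicator (\<phi> -` A) g \<partial>\<mu>G) \<le> (\<integral>\<^sup>+g. I g \<partial>\<mu>G) + (\<integral>\<^sup>+g. ennreal c * indicator (\<phi> -` W) g \<partial>\<mu>G)"
        using pointwise by (subst nn_integral_add[symmetric]) (auto intro!: nn_integral_mono simp: close_upto_def)
    qed
    then have "close_upto (emeasure \<mu>H A) (ennreal c * emeasure \<mu>G (\<phi> -` A)) (ennreal c * emeasure \<mu>G (\<phi> -` W))"
      by (simp add: int_I nn_integral_cmult_indicator)
    then have "close_upto (ennreal (1 / c) * emeasure \<mu>H A) (ennreal (1 / c) * (ennreal c * emeasure \<mu>G (\<phi> -` A)))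
        (ennreal (1 / c) * (ennreal c * emeasure \<mu>G (\<phi> -` W)))"
      by (rule close_upto_mult)
    moreover have "ennreal (1 / c) * (ennreal c * x) = x" for x
      using c(1) by (simp add: mult.assoc[symmetric] ennreal_mult[symmetric])
    ultimately show ?thesis
      using Wle unfolding quasi_measure_on_def by (metis close_upto_mono)
  qed
  moreover have "1 / c > 0" using c(1) by simp
  ultimately have "has_scaling_factor (word_metric SG) \<mu>G (word_metric SH) \<mu>H \<phi> (1 / c)"
    using GI.standard HI.standard map_quasi_isometry map_measurable a(1) by (intro has_scaling_factorI)
  then show ?thesis by blast
qed

text \<open>
  A countable net gives a countable Borel partition of \<open>H\<close> into sets of bounded diameter, and \<open>\<psi>\<close> is constant
  on each part.
\<close>

lemma measurable_quasi_inverse: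
  obtains \<psi> K where "\<psi> \<in> \<mu>H \<rightarrow>\<^sub>M \<mu>G" "\<And>h. word_metric SH (\<phi> (\<psi> h)) h \<le> K"
proof -
  interpret HI: integral_mms "word_metric SH" \<mu>H by (rule H.integral_mms_word_metric)
  obtain K where K: "\<And>y. \<exists>x. word_metric SH y (\<phi> x) \<le> K"
    using map_quasi_isometry unfolding quasi_isometry_def by blast
  then obtain p where p: "\<And>y. word_metric SH y (\<phi> (p y)) \<le> K" by metis
  have "\<exists>t. finite t \<and> {h. H.len h \<le> n} \<subseteq> (\<Union>z\<in>t. dball (word_metric SH) z 2)" for n :: nat
  proof -
    obtain t where "finite t" "{h. H.len h \<le> n} \<subseteq> (\<Union>z\<in>t. {x. H.len (- z + x) \<le> 2})"
      using H.compact_finite_net[OF H.compact_len_ball] by metis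
    moreover have "{x. H.len (- z + x) \<le> 2} = dball (word_metric SH) z 2" for z
      by (auto simp: word_metric_def)
    ultimately show ?thesis by auto
  qed
  then obtain t where t: "\<And>n. finite (t n)" "\<And>n. {h. H.len h \<le> n} \<subseteq> (\<Union>z\<in>t n. dball (word_metric SH) z 2)"
    by metis
  define T where "T = (\<Union>n. t n)"
  have "countable T" unfolding T_def using t(1) by (auto intro: countable_finite)
  have near: "\<exists>z\<in>T. word_metric SH z h \<le> 2" for h using t(2)[of "H.len h"] by (force simp: T_def)
  then have "T \<noteq> {}" by blast
  \<comment> \<open>Send \<open>h\<close> to the first element of the countable net that is close to it.\<close>
  define k where "k h = (LEAST i. word_metric SH (from_nat_into T i) h \<le> 2)" for h
  have k: "word_metric SH (from_nat_into T (k h)) h \<le> 2" for h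
  proof -
    obtain i where "word_metric SH (from_nat_into T i) h \<le> 2"
      using near[of h] from_nat_into_to_nat_on[OF \<open>countable T\<close>] by metis
    then show ?thesis unfolding k_def by (rule LeastI)
  qed
  have "(\<lambda>h. word_metric SH z h \<le> 2) \<in> \<mu>H \<rightarrow>\<^sub>M count_space UNIV" for z
    using HI.ball_measurable[of z 2] by (simp add: pred_def[symmetric] pred_def)
  then have k_meas: "k \<in> \<mu>H \<rightarrow>\<^sub>M count_space UNIV"
    unfolding k_def by (intro measurable_Least)
  define \<psi> where "\<psi> h = p (from_nat_into T (k h))" for h
  have "\<psi> \<in> \<mu>H \<rightarrow>\<^sub>M \<mu>G"
    unfolding \<psi>_def by (rule measurable_compose[OF k_meas]) simp
  moreover have "word_metric SH (\<phi> (\<psi> h)) h \<le> K + 2" for h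
    using HI.triangle[of "\<phi> (\<psi> h)" h "from_nat_into T (k h)"] p[of "from_nat_into T (k h)"] k[of h]
      HI.sym[of "\<phi> (\<psi> h)"] unfolding \<psi>_def by simp
  ultimately show thesis using that by blast
qed

text \<open>
  Conjugation by \<open>\<phi>\<close> and a quasi-inverse: the factors \<open>\<kappa>\<close> and \<open>1 / \<kappa>\<close> cancel.
\<close>

theorem scaling_group_eq: "Sc (word_metric SH) \<mu>H = Sc (word_metric SG) \<mu>G"
proof -
  note GI = G.integral_mms_word_metric and HI = H.integral_mms_word_metric
  obtain \<kappa> where \<kappa>: "has_scaling_factor (word_metric SG) \<mu>G (word_metric SH) \<mu>H \<phi> \<kappa>"
    using map_scaling_factor by blast
  obtain \<psi> K where \<psi>: "\<psi> \<in> \<mu>H \<rightarrow>\<^sub>M \<mu>G" "\<And>h. word_metric SH (\<phi> (\<psi> h)) h \<le> K"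
    using measurable_quasi_inverse by metis
  have \<psi>_factor: "has_scaling_factor (word_metric SH) \<mu>H (word_metric SG) \<mu>G \<psi> (1 / \<kappa>)"
    by (rule has_scaling_factor_quasi_inverse[OF GI HI \<kappa> \<psi>])
  have "\<kappa> > 0" using \<kappa> by (simp add: has_scaling_factor_def quasi_to_one_def)
  show ?thesis
    unfolding Sc_def
  proof (intro set_eqI iffI; clarify)
    fix \<tau> f assume f: "has_scaling_factor (word_metric SH) \<mu>H (word_metric SH) \<mu>H f \<tau>"
    have "\<kappa> * \<tau> * (1 / \<kappa>) = \<tau>" using \<open>\<kappa> > 0\<close> by simp
    with has_scaling_factor_compose[OF GI HI GI has_scaling_factor_compose[OF GI HI HI \<kappa> f] \<psi>_factor]
    have "has_scaling_factor (word_metric SG) \<mu>G (word_metric SG) \<mu>G (\<lambda>x. \<psi> (f (\<phi> x))) \<tau>"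
      by (simp only:)
    then show "\<exists>f. has_scaling_factor (word_metric SG) \<mu>G (word_metric SG) \<mu>G f \<tau>"
      by (intro exI[of _ "\<lambda>x. \<psi> (f (\<phi> x))"])
  next
    fix \<tau> f assume f: "has_scaling_factor (word_metric SG) \<mu>G (word_metric SG) \<mu>G f \<tau>"
    have "1 / \<kappa> * \<tau> * \<kappa> = \<tau>" using \<open>\<kappa> > 0\<close> by simp
    with has_scaling_factor_compose[OF HI GI HI has_scaling_factor_compose[OF HI GI GI \<psi>_factor f] \<kappa>]
    have "has_scaling_factor (word_metric SH) \<mu>H (word_metric SH) \<mu>H (\<lambda>x. \<phi> (f (\<psi> x))) \<tau>"
      by (simp only:)
    then show "\<exists>f. has_scaling_factor (word_metric SH) \<mu>H (word_metric SH) \<mu>H f \<tau>"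
      by (intro exI[of _ "\<lambda>x. \<phi> (f (\<psi> x))"])
  qed
qed

end

theorem proposition1p4:
  fixes \<mu>G :: "'g::{topological_group_add, t2_space} measure"
    and \<mu>H :: "'h::{topological_group_add, t2_space} measure"
    and SG :: "'g set" and SH :: "'h set"
    and \<phi> :: "'g \<Rightarrow> 'h"
  assumes "locally_compact_space (euclidean :: 'g topology)"
    and "locally_compact_space (euclidean :: 'h topology)"
    and "compact_generating_set SG" and "compact_generating_set SH"
    and "left_haar_measure \<mu>G" and "left_haar_measure \<mu>H"
    and "group_morphism \<phi>" and "continuous_on UNIV \<phi>"
    and "proper_morphism \<phi>" and "cocompact_morphism \<phi>"
  shows "measure_scaling_quasi_isometry (word_metric SG) \<mu>G (word_metric SH) \<mu>H \<phi> \<and>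
    (amenable_mms (word_metric SG) \<mu>G \<and> amenable_mms (word_metric SH) \<mu>H \<longrightarrow>
       Sc (word_metric SH) \<mu>H = Sc (word_metric SG) \<mu>G)"
proof -
  interpret proper_cocompact_morphism SG \<mu>G SH \<mu>H \<phi>
    using assms by unfold_locales
  show ?thesis
    using map_scaling_factor scaling_group_eq by (simp add: measure_scaling_quasi_isometry_def)
qed

end
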